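(* Fix $k\in\mathbb{N}$ and let $H_n^k$ be the length of the longest monotone subsequence in a uniformly random element of $L_n^k$. Then: (1) for every $\varepsilon>0$, $H_n^k n^{-\frac{k}{k+1}}\in\left[\frac{1}{k+2},e+\varepsilon\right]$ asymptotically almost surely (with probability tending to $1$ as $n\to\infty$); (2) $1-\frac{\ln k+1}{k+1}-o(1)\le E\left[H_n^k n^{-\frac{k}{k+1}}\right]\le e+o(1)$.
   Context: An order-$n$ $k$-dimensional permutation is an array $A:[n]^{k+1}\to\{0,1\}$ such that every line contains exactly one $1$, where a line is the set of positions obtained by fixing $k$ of the $k+1$ coordinates and letting the remaining coordinate range over $[n]$; $L_n^k$ is the set of these, and $G_A=\{\alpha:A(\alpha)=1\}$. A monotone subsequence of length $m$ in $A$ is a sequence $\alpha^1,\dots,\alpha^m\in G_A$ such that for every coordinate $1\le j\le k+1$ the sequence $\alpha^1_j,\dots,\alpha^m_j$ is strictly monotone (the direction may depend on $j$). The $o(1)$ terms are as $n\to\infty$ with $k$ fixed. *)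

theory Defs
  imports
    "HOL-Probability.Probability_Mass_Function"
    "HOL-Library.Landau_Symbols"
    "HOL-Library.FuncSet"
begin

(* [n]^(k+1) as extensional functions on the coordinates 1, ..., k+1, so that the type carries
   no junk elements outside the domain. *)
definition positions :: "nat \<Rightarrow> nat \<Rightarrow> (nat \<Rightarrow> nat) set" where
  "positions n k = {1..k+1} \<rightarrow>\<^sub>E {1..n}"

definition lines :: "nat \<Rightarrow> nat \<Rightarrow> (nat \<Rightarrow> nat) set set" where
  "lines n k = {{\<beta> \<in> positions n k. \<forall>i\<in>{1..k+1} - {j}. \<beta> i = \<alpha> i} | \<alpha> j.
      \<alpha> \<in> positions n k \<and> j \<in> {1..k+1}}"

(* L_n^k. Arrays are extensional on the positions, which makes this set finite, with one element
   per array. *)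
definition hd_perms :: "nat \<Rightarrow> nat \<Rightarrow> ((nat \<Rightarrow> nat) \<Rightarrow> nat) set" where
  "hd_perms n k = {A \<in> positions n k \<rightarrow>\<^sub>E {0, 1}.
      \<forall>l\<in>lines n k. \<exists>!\<alpha>. \<alpha> \<in> l \<and> A \<alpha> = 1}"

(* G_A *)
definition ones :: "nat \<Rightarrow> nat \<Rightarrow> ((nat \<Rightarrow> nat) \<Rightarrow> nat) \<Rightarrow> (nat \<Rightarrow> nat) set" where
  "ones n k A = {\<alpha> \<in> positions n k. A \<alpha> = 1}"

(* s 1, ..., s m are the terms of the sequence; the values of s elsewhere are irrelevant. *)
definition monotone_subseq ::
  "nat \<Rightarrow> nat \<Rightarrow> ((nat \<Rightarrow> nat) \<Rightarrow> nat) \<Rightarrow> nat \<Rightarrow> (nat \<Rightarrow> nat \<Rightarrow> nat) \<Rightarrow> bool" where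
  "monotone_subseq n k A m s \<longleftrightarrow>
      (\<forall>i\<in>{1..m}. s i \<in> ones n k A) \<and>
      (\<forall>j\<in>{1..k+1}. strict_mono_on {1..m} (\<lambda>i. s i j) \<or> strict_antimono_on {1..m} (\<lambda>i. s i j))"

definition longest_monotone :: "nat \<Rightarrow> nat \<Rightarrow> ((nat \<Rightarrow> nat) \<Rightarrow> nat) \<Rightarrow> nat" where
  "longest_monotone n k A = Max {m. \<exists>s. monotone_subseq n k A m s}"

definition random_hd_perm :: "nat \<Rightarrow> nat \<Rightarrow> ((nat \<Rightarrow> nat) \<Rightarrow> nat) pmf" where
  "random_hd_perm n k = pmf_of_set (hd_perms n k)"

definition normalized_H :: "nat \<Rightarrow> nat \<Rightarrow> ((nat \<Rightarrow> nat) \<Rightarrow> nat) \<Rightarrow> real" where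
  "normalized_H n k A = real (longest_monotone n k A) * real n powr (- (real k / real (k + 1)))"

(* The remaining facts show that Max and pmf_of_set are applied to finite nonempty sets. *)

lemma finite_positions: "finite (positions n k)"
  unfolding positions_def by (intro finite_PiE) auto

lemma finite_hd_perms: "finite (hd_perms n k)"
proof -
  have "finite (positions n k \<rightarrow>\<^sub>E {0, 1 :: nat})"
    by (intro finite_PiE finite_positions) auto
  then show ?thesis unfolding hd_perms_def by (rule rev_finite_subset) auto
qed

lemma ex1_dvd_add:
  fixes n S :: nat
  assumes "n \<ge> 1"
  shows "\<exists>!t. t \<in> {1..n} \<and> n dvd S + t"
proof (rule ex1I)
  have "S mod n < n" using assms by simp
  moreover have "n dvd S + (n - S mod n)"
  proof -
    have "S + (n - S mod n) = S div n * n + n"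
      using div_mult_mod_eq[of S n] \<open>S mod n < n\<close> by linarith
    then show ?thesis by simp
  qed
  ultimately show "n - S mod n \<in> {1..n} \<and> n dvd S + (n - S mod n)" by auto
next
  fix t assume t: "t \<in> {1..n} \<and> n dvd S + t"
  then have "n dvd S div n * n + (S mod n + t)"
    by (simp add: add.assoc[symmetric])
  then have "n dvd S mod n + t" using dvd_add_right_iff[OF dvd_triv_right] by blast
  then obtain c where c: "S mod n + t = n * c" by (rule dvdE)
  have "S mod n < n" using assms by simp
  have "1 \<le> t" "t \<le> n" using t by auto
  with c \<open>S mod n < n\<close> have "n * c < n * 2" "n * 0 < n * c" by linarith+
  then have "c < 2" "0 < c" using mult_less_cancel1 by blast+
  then have "c = 1" by simp
  with c have "S mod n + t = n" by (simp only: mult_1_right)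
  then show "t = n - S mod n" by linarith
qed

lemma hd_perms_nonempty: "hd_perms n k \<noteq> {}"
proof -
  define A where "A = (\<lambda>\<alpha>\<in>positions n k. if n dvd (\<Sum>i\<in>{1..k+1}. \<alpha> i) then 1 else (0::nat))"
  have "\<exists>!\<beta>. \<beta> \<in> l \<and> A \<beta> = 1" if "l \<in> lines n k" for l
  proof -
    from that obtain \<alpha> j where \<alpha>: "\<alpha> \<in> positions n k" and j: "j \<in> {1..k+1}"
      and l: "l = {\<beta> \<in> positions n k. \<forall>i\<in>{1..k+1} - {j}. \<beta> i = \<alpha> i}"
      unfolding lines_def by blast
    define S where "S = (\<Sum>i\<in>{1..k+1} - {j}. \<alpha> i)"
    have "\<alpha> j \<in> {1..n}" using \<alpha> j unfolding positions_def by (rule PiE_mem)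
    then have n: "n \<ge> 1" by simp
    have sum: "(\<Sum>i\<in>{1..k+1}. \<beta> i) = S + \<beta> j" if "\<beta> \<in> l" for \<beta>
    proof -
      have "(\<Sum>i\<in>{1..k+1}. \<beta> i) = \<beta> j + (\<Sum>i\<in>{1..k+1} - {j}. \<beta> i)"
        using j by (intro sum.remove) auto
      also have "(\<Sum>i\<in>{1..k+1} - {j}. \<beta> i) = S"
        unfolding S_def using that l by (intro sum.cong) auto
      finally show ?thesis by simp
    qed
    have A: "A \<beta> = 1 \<longleftrightarrow> n dvd S + \<beta> j" if "\<beta> \<in> l" for \<beta>
      using that sum[OF that] unfolding A_def l by simp
    obtain t where t: "t \<in> {1..n}" "n dvd S + t" using ex1_dvd_add[OF n] by blast
    show ?thesis
    proof (rule ex1I)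
      have "\<alpha>(j := t) \<in> l" using \<alpha> j t unfolding l positions_def
        by (auto simp: PiE_iff extensional_def)
      then show "\<alpha>(j := t) \<in> l \<and> A (\<alpha>(j := t)) = 1" using A t by simp
    next
      fix \<beta> assume \<beta>: "\<beta> \<in> l \<and> A \<beta> = 1"
      then have "n dvd S + \<beta> j" using A by blast
      moreover have "\<beta> j \<in> {1..n}" using \<beta> j unfolding l positions_def by blast
      ultimately have "\<beta> j = t" using t ex1_dvd_add[OF n, of S] by blast
      show "\<beta> = \<alpha>(j := t)"
      proof
        fix x
        show "\<beta> x = (\<alpha>(j := t)) x"
        proof (cases "x \<in> {1..k+1} - {j}")
          case True
          then show ?thesis using \<beta> unfolding l by simp
        next
          case False
          then show ?thesis using \<beta> \<alpha> \<open>\<beta> j = t\<close> unfolding l positions_def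
            by (auto simp: PiE_iff extensional_def)
        qed
      qed
    qed
  qed
  moreover have "A \<in> positions n k \<rightarrow>\<^sub>E {0, 1}" unfolding A_def by auto
  ultimately have "A \<in> hd_perms n k"
    unfolding hd_perms_def by (intro CollectI conjI ballI)
  then show ?thesis by (metis empty_iff)
qed

lemma monotone_subseq_length_le:
  assumes "monotone_subseq n k A m s"
  shows "m \<le> n"
proof -
  have "strict_mono_on {1..m} (\<lambda>i. s i 1) \<or> strict_antimono_on {1..m} (\<lambda>i. s i 1)"
    using assms unfolding monotone_subseq_def by simp
  then have "s i 1 \<noteq> s j 1" if "i \<in> {1..m}" "j \<in> {1..m}" "i < j" for i j
    using that unfolding monotone_on_def by (metis less_irrefl)
  then have "inj_on (\<lambda>i. s i 1) {1..m}"
    by (intro linorder_inj_onI) auto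
  moreover have "(\<lambda>i. s i 1) ` {1..m} \<subseteq> {1..n}"
    using assms unfolding monotone_subseq_def ones_def positions_def by (auto simp: PiE_iff)
  ultimately have "card {1..m} \<le> card {1..n}" by (metis card_inj_on_le finite_atLeastAtMost)
  then show ?thesis by simp
qed

lemma finite_monotone_subseq_lengths: "finite {m. \<exists>s. monotone_subseq n k A m s}"
  by (rule finite_subset[of _ "{..n}"]) (auto dest: monotone_subseq_length_le)

lemma monotone_subseq_lengths_nonempty: "{m. \<exists>s. monotone_subseq n k A m s} \<noteq> {}"
proof -
  have "monotone_subseq n k A 0 s" for s
    by (simp add: monotone_subseq_def monotone_on_def)
  then show ?thesis by blast
qed

end

(* Relabelling the values of one coordinate preserves the uniform distribution on L_n^k. Hence a
   position with a coordinate value not used by a set R of r positions lies in G_A together with R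
   with probability at most 1/(n-r) times the probability that R lies in G_A: the position can be
   moved along its line, which contains a single one.

   Upper tail: the m positions of a monotone sequence all lie in G_A with probability at most
   (n-m)!/n!, and there are at most (2 (n choose m))^(k+1) such sequences.

   Lower tail: cut the diagonal into N cubes of side s with s^(k+1) close to C n. A one from each
   nonempty cube gives an increasing sequence, and the number of nonempty cubes is at least the sum
   of 2 a X - a^2 X^2 over the cubes, X being the number of ones. The first two moments of X with
   C = k, a = 1/(k+1) give the expectation; for the bound with high probability, C = 1, a = 1/2 and
   Chebyshev's inequality for the sums of X and of X^2. *)

theory Submission
  imports Defs "HOL-Combinatorics.Transposition" "HOL-Real_Asymp.Real_Asymp"
begin

subsection \<open>Averages over all arrays\<close>

text \<open>Arrays are never counted, and the numbers of ones in different cubes are not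
  independent; everything rests on ratios of probabilities given by one symmetry. It bounds the
  probability of a set of positions from above. Upper bounds suffice for the union bound and for the
  expectation; only the concentration of the sum of the \<open>X\<^sup>2\<close> also asks for a
  lower bound, and only for pairs. Its variance involves four positions, and the symmetry is silent
  about a position all of whose coordinate values are already used; such positions are few and are
  counted separately. Origin of the constants: in the limit X has mean C and second moment C + C^2,
  as a Poisson variable has. Then 2 a C - a^2 (C + C^2) is largest at a = 1/(1+C), with value
  C/(1+C). About C^(-1/(k+1)) n^(k/(k+1)) cubes fit on the diagonal, and C^(k/(k+1))/(1+C) is
  largest at C = k. With high probability only 1/(k+2) <= 1/3 has to be beaten, and C = 1, a = 1/2
  already gives 1/2. The e of the upper bounds comes from m! >= (m/e)^m.\<close>

definition mean :: "nat \<Rightarrow> nat \<Rightarrow> (((nat \<Rightarrow> nat) \<Rightarrow> nat) \<Rightarrow> real) \<Rightarrow> real" where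
  "mean n k f = (\<Sum>A\<in>hd_perms n k. f A) / real (card (hd_perms n k))"

text \<open>The argument is a set, so coinciding indices in a moment sum merge by themselves, and
  moments need no case distinction on which positions are equal.\<close>

definition hit_prob :: "nat \<Rightarrow> nat \<Rightarrow> (nat \<Rightarrow> nat) set \<Rightarrow> real" where
  "hit_prob n k R = mean n k (\<lambda>A. of_bool (R \<subseteq> ones n k A))"

lemma card_hd_perms_pos: "0 < card (hd_perms n k)"
  using finite_hd_perms hd_perms_nonempty by (simp add: card_gt_0_iff)

lemma expectation_eq_mean: "measure_pmf.expectation (random_hd_perm n k) f = mean n k f"
  unfolding random_hd_perm_def mean_def
  by (rule integral_pmf_of_set[OF hd_perms_nonempty finite_hd_perms])

lemma prob_eq_mean:
  "measure_pmf.prob (random_hd_perm n k) {A. P A} = mean n k (\<lambda>A. of_bool (P A))"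
  unfolding random_hd_perm_def mean_def
  by (simp add: measure_pmf_of_set[OF hd_perms_nonempty finite_hd_perms] of_bool_def
      sum.If_cases finite_hd_perms)

lemma mean_mono:
  assumes "\<And>A. A \<in> hd_perms n k \<Longrightarrow> f A \<le> g A"
  shows "mean n k f \<le> mean n k g"
  unfolding mean_def by (intro divide_right_mono sum_mono assms) auto

lemma mean_cong:
  assumes "\<And>A. A \<in> hd_perms n k \<Longrightarrow> f A = g A"
  shows "mean n k f = mean n k g"
  unfolding mean_def using assms by simp

lemma mean_nonneg:
  assumes "\<And>A. A \<in> hd_perms n k \<Longrightarrow> 0 \<le> f A"
  shows "0 \<le> mean n k f"
  unfolding mean_def by (intro divide_nonneg_nonneg sum_nonneg assms) auto

lemma mean_add: "mean n k (\<lambda>A. f A + g A) = mean n k f + mean n k g"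
  unfolding mean_def by (simp add: sum.distrib add_divide_distrib)

lemma mean_diff: "mean n k (\<lambda>A. f A - g A) = mean n k f - mean n k g"
  unfolding mean_def by (simp add: sum_subtractf diff_divide_distrib)

lemma mean_cmult: "mean n k (\<lambda>A. c * f A) = c * mean n k f"
  unfolding mean_def by (simp add: sum_distrib_left[symmetric])

lemma mean_const: "mean n k (\<lambda>A. c) = c"
  unfolding mean_def using card_hd_perms_pos[of n k] by simp

lemma mean_sum: "mean n k (\<lambda>A. \<Sum>i\<in>I. f i A) = (\<Sum>i\<in>I. mean n k (f i))"
  unfolding mean_def by (subst sum.swap) (simp add: sum_divide_distrib)

lemma hit_prob_nonneg: "0 \<le> hit_prob n k R"
  unfolding hit_prob_def by (rule mean_nonneg) simp

lemma hit_prob_empty: "hit_prob n k {} = 1"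
  unfolding hit_prob_def by (simp add: mean_const)

lemma hit_prob_antimono: "R \<subseteq> S \<Longrightarrow> hit_prob n k S \<le> hit_prob n k R"
  unfolding hit_prob_def by (rule mean_mono) auto

subsection \<open>Relabelling one coordinate\<close>

lemma positions_upd:
  assumes "\<alpha> \<in> positions n k" "j \<in> {1..k+1}" "t \<in> {1..n}"
  shows "\<alpha>(j := t) \<in> positions n k"
  using assms unfolding positions_def by (auto simp: PiE_iff extensional_def)

lemma positions_in: "\<alpha> \<in> positions n k \<Longrightarrow> j \<in> {1..k+1} \<Longrightarrow> \<alpha> j \<in> {1..n}"
  unfolding positions_def by (rule PiE_mem)

lemma positions_eqI:
  assumes "\<alpha> \<in> positions n k" "\<beta> \<in> positions n k" "\<And>i. i \<in> {1..k+1} \<Longrightarrow> \<alpha> i = \<beta> i"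
  shows "\<alpha> = \<beta>"
  using assms unfolding positions_def by (rule PiE_ext)

lemma line_eq:
  assumes "\<alpha> \<in> positions n k" "j \<in> {1..k+1}"
  shows "{\<beta> \<in> positions n k. \<forall>i\<in>{1..k+1} - {j}. \<beta> i = \<alpha> i} = (\<lambda>t. \<alpha>(j := t)) ` {1..n}"
proof (intro equalityI subsetI)
  fix \<beta> assume "\<beta> \<in> {\<beta> \<in> positions n k. \<forall>i\<in>{1..k+1} - {j}. \<beta> i = \<alpha> i}"
  then have b: "\<beta> \<in> positions n k" "\<And>i. i \<in> {1..k+1} - {j} \<Longrightarrow> \<beta> i = \<alpha> i" by auto
  have t: "\<beta> j \<in> {1..n}" using positions_in[OF b(1) assms(2)] .
  have "\<beta> = \<alpha>(j := \<beta> j)"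
    by (rule positions_eqI[OF b(1) positions_upd[OF assms t]]) (use b(2) in auto)
  with t show "\<beta> \<in> (\<lambda>t. \<alpha>(j := t)) ` {1..n}" by blast
next
  fix \<beta> assume "\<beta> \<in> (\<lambda>t. \<alpha>(j := t)) ` {1..n}"
  then show "\<beta> \<in> {\<beta> \<in> positions n k. \<forall>i\<in>{1..k+1} - {j}. \<beta> i = \<alpha> i}"
    using positions_upd[OF assms] by (auto split: if_splits)
qed

text \<open>Lines are replaced by a position, a direction and the value of the free coordinate;
  relabelling and summation along a line both use this form.\<close>

lemma hd_perms_iff:
  "A \<in> hd_perms n k \<longleftrightarrow> A \<in> positions n k \<rightarrow>\<^sub>E {0, 1} \<and>
     (\<forall>\<alpha>\<in>positions n k. \<forall>j\<in>{1..k+1}. \<exists>!t. t \<in> {1..n} \<and> A (\<alpha>(j := t)) = 1)"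
proof -
  have *: "(\<exists>!\<beta>. \<beta> \<in> (\<lambda>t. \<alpha>(j := t)) ` {1..n} \<and> A \<beta> = 1) \<longleftrightarrow>
     (\<exists>!t. t \<in> {1..n} \<and> A (\<alpha>(j := t)) = 1)" for \<alpha> :: "nat \<Rightarrow> nat" and j
  proof -
    have inj: "\<alpha>(j := t) = \<alpha>(j := u) \<longleftrightarrow> t = u" for t u
      by (metis fun_upd_same)
    show ?thesis
    proof
      assume "\<exists>!\<beta>. \<beta> \<in> (\<lambda>t. \<alpha>(j := t)) ` {1..n} \<and> A \<beta> = 1"
      then obtain t where "t \<in> {1..n}" "A (\<alpha>(j := t)) = 1"
        "\<And>\<beta>. \<beta> \<in> (\<lambda>t. \<alpha>(j := t)) ` {1..n} \<Longrightarrow> A \<beta> = 1 \<Longrightarrow> \<beta> = \<alpha>(j := t)"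
        by blast
      then show "\<exists>!t. t \<in> {1..n} \<and> A (\<alpha>(j := t)) = 1"
        using inj by (intro ex1I[of _ t]) blast+
    next
      assume "\<exists>!t. t \<in> {1..n} \<and> A (\<alpha>(j := t)) = 1"
      then obtain t where "t \<in> {1..n}" "A (\<alpha>(j := t)) = 1"
        "\<And>u. u \<in> {1..n} \<Longrightarrow> A (\<alpha>(j := u)) = 1 \<Longrightarrow> u = t"
        by blast
      then show "\<exists>!\<beta>. \<beta> \<in> (\<lambda>t. \<alpha>(j := t)) ` {1..n} \<and> A \<beta> = 1"
        by (intro ex1I[of _ "\<alpha>(j := t)"]) blast+
    qed
  qed
  have "(\<forall>l\<in>lines n k. Q l) \<longleftrightarrow> (\<forall>\<alpha>\<in>positions n k. \<forall>j\<in>{1..k+1}. Q ((\<lambda>t. \<alpha>(j := t)) ` {1..n}))"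
    for Q :: "(nat \<Rightarrow> nat) set \<Rightarrow> bool"
  proof -
    have "(\<forall>l\<in>lines n k. Q l) \<longleftrightarrow> (\<forall>\<alpha>\<in>positions n k. \<forall>j\<in>{1..k+1}.
        Q {\<beta> \<in> positions n k. \<forall>i\<in>{1..k+1} - {j}. \<beta> i = \<alpha> i})"
      unfolding lines_def by blast
    also have "\<dots> \<longleftrightarrow> (\<forall>\<alpha>\<in>positions n k. \<forall>j\<in>{1..k+1}. Q ((\<lambda>t. \<alpha>(j := t)) ` {1..n}))"
      by (intro ball_cong refl) (simp only: line_eq)
    finally show ?thesis .
  qed
  then show ?thesis unfolding hd_perms_def mem_Collect_eq by (simp only: *)
qed

text \<open>A transposition of two values suffices, and being its own inverse it makes the induced
  map on arrays an involution, hence a bijection.\<close>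

definition relabel :: "nat \<Rightarrow> nat \<Rightarrow> nat \<Rightarrow> (nat \<Rightarrow> nat) \<Rightarrow> nat \<Rightarrow> nat" where
  "relabel i a b \<alpha> = \<alpha>(i := Transposition.transpose a b (\<alpha> i))"

lemma relabel_relabel [simp]: "relabel i a b (relabel i a b \<alpha>) = \<alpha>"
  unfolding relabel_def by simp

lemma transpose_in:
  assumes "a \<in> X" "b \<in> X"
  shows "Transposition.transpose a b t \<in> X \<longleftrightarrow> t \<in> X"
  using assms by (metis transpose_eq_iff transpose_apply_other)

lemma relabel_positions:
  assumes "i \<in> {1..k+1}" "a \<in> {1..n}" "b \<in> {1..n}"
  shows "relabel i a b \<alpha> \<in> positions n k \<longleftrightarrow> \<alpha> \<in> positions n k"
proof -
  have "relabel i a b \<alpha> \<in> positions n k" if "\<alpha> \<in> positions n k" for \<alpha>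
    unfolding relabel_def
    using positions_upd[OF that assms(1)] positions_in[OF that assms(1)] transpose_in[OF assms(2,3)]
    by blast
  then show ?thesis by (metis relabel_relabel)
qed

text \<open>A line in direction \<open>i\<close> is permuted within itself, and a line in another
  direction is carried onto a parallel line, so each line keeps its single one.\<close>

lemma relabel_hd_perms:
  assumes i: "i \<in> {1..k+1}" and ab: "a \<in> {1..n}" "b \<in> {1..n}" and A: "A \<in> hd_perms n k"
  shows "(\<lambda>\<alpha>\<in>positions n k. A (relabel i a b \<alpha>)) \<in> hd_perms n k"
    (is "?B \<in> _")
proof -
  note rp = relabel_positions[OF i ab]
  have Ar: "A \<in> positions n k \<rightarrow>\<^sub>E {0, 1}"
    and A1: "\<And>\<alpha> j. \<alpha> \<in> positions n k \<Longrightarrow> j \<in> {1..k+1} \<Longrightarrow> \<exists>!t. t \<in> {1..n} \<and> A (\<alpha>(j := t)) = 1"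
    using A unfolding hd_perms_iff by blast+
  have "?B \<in> positions n k \<rightarrow>\<^sub>E {0, 1}"
    using Ar rp by (intro restrict_PiE_iff[THEN iffD2] ballI) (blast dest: PiE_mem)
  moreover have "\<exists>!t. t \<in> {1..n} \<and> ?B (\<alpha>(j := t)) = 1"
    if \<alpha>: "\<alpha> \<in> positions n k" and j: "j \<in> {1..k+1}" for \<alpha> j
  proof (cases "j = i")
    case True
    have B: "?B (\<alpha>(j := t)) = A (\<alpha>(j := Transposition.transpose a b t))" if "t \<in> {1..n}" for t
      using positions_upd[OF \<alpha> j that] True by (simp add: relabel_def)
    obtain u where u: "u \<in> {1..n}" "A (\<alpha>(j := u)) = 1"
      "\<And>v. v \<in> {1..n} \<Longrightarrow> A (\<alpha>(j := v)) = 1 \<Longrightarrow> v = u"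
      using A1[OF \<alpha> j] by blast
    show ?thesis
    proof (rule ex1I[of _ "Transposition.transpose a b u"])
      show "Transposition.transpose a b u \<in> {1..n} \<and> ?B (\<alpha>(j := Transposition.transpose a b u)) = 1"
        using u(1,2) B[of "Transposition.transpose a b u"] transpose_in[OF ab] by simp
    next
      fix t assume t: "t \<in> {1..n} \<and> ?B (\<alpha>(j := t)) = 1"
      then have "A (\<alpha>(j := Transposition.transpose a b t)) = 1" using B by metis
      then have "Transposition.transpose a b t = u" using u(3) t transpose_in[OF ab] by blast
      then show "t = Transposition.transpose a b u" by (metis transpose_involutory)
    qed
  next
    case False
    have B: "?B (\<alpha>(j := t)) = A ((relabel i a b \<alpha>)(j := t))" if "t \<in> {1..n}" for t
      using positions_upd[OF \<alpha> j that] False by (simp add: relabel_def fun_upd_twist)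
    show ?thesis using A1[OF rp[THEN iffD2, OF \<alpha>] j] B by metis
  qed
  ultimately show ?thesis unfolding hd_perms_iff by blast
qed

text \<open>The involution \<open>\<Phi>\<close> of the set of arrays exchanges the event for
  \<open>R\<close> with the event for its relabelled image.\<close>

lemma hit_prob_relabel:
  assumes i: "i \<in> {1..k+1}" and ab: "a \<in> {1..n}" "b \<in> {1..n}" and R: "R \<subseteq> positions n k"
  shows "hit_prob n k (relabel i a b ` R) = hit_prob n k R"
proof -
  define \<Phi> where "\<Phi> = (\<lambda>A :: (nat \<Rightarrow> nat) \<Rightarrow> nat. \<lambda>\<alpha>\<in>positions n k. A (relabel i a b \<alpha>))"
  note rp = relabel_positions[OF i ab]
  have L: "\<Phi> A \<in> hd_perms n k" if "A \<in> hd_perms n k" for A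
    unfolding \<Phi>_def by (rule relabel_hd_perms[OF i ab that])
  have inv: "\<Phi> (\<Phi> A) = A" if "A \<in> hd_perms n k" for A
  proof -
    have "A \<in> positions n k \<rightarrow>\<^sub>E {0, 1}" using that unfolding hd_perms_def by blast
    then show ?thesis unfolding \<Phi>_def
      by (auto simp: fun_eq_iff rp PiE_iff extensional_def)
  qed
  have eq: "relabel i a b ` R \<subseteq> ones n k A \<longleftrightarrow> R \<subseteq> ones n k (\<Phi> A)" for A
    using R unfolding ones_def \<Phi>_def by (auto simp: rp)
  have "(\<Sum>A\<in>hd_perms n k. of_bool (relabel i a b ` R \<subseteq> ones n k A) :: real)
      = (\<Sum>A\<in>hd_perms n k. of_bool (R \<subseteq> ones n k A))"
    by (rule sum.reindex_bij_witness[of _ \<Phi> \<Phi>]) (auto simp: L inv eq)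
  then show ?thesis unfolding hit_prob_def mean_def by simp
qed

text \<open>Each array has its one on this line at exactly one \<open>t\<close>, so the events on
  the left partition the event for \<open>R\<close>.\<close>

lemma hit_prob_insert_sum_line:
  assumes "\<beta> \<in> positions n k" "i \<in> {1..k+1}"
  shows "(\<Sum>t\<in>{1..n}. hit_prob n k (insert (\<beta>(i := t)) R)) = hit_prob n k R"
proof -
  have "(\<Sum>t\<in>{1..n}. of_bool (insert (\<beta>(i := t)) R \<subseteq> ones n k A)) = (of_bool (R \<subseteq> ones n k A) :: real)"
    if "A \<in> hd_perms n k" for A
  proof -
    have "\<exists>!t. t \<in> {1..n} \<and> A (\<beta>(i := t)) = 1"
      using that assms unfolding hd_perms_iff by blast
    then obtain u where u: "u \<in> {1..n}" "A (\<beta>(i := u)) = 1"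
      "\<And>v. v \<in> {1..n} \<Longrightarrow> A (\<beta>(i := v)) = 1 \<Longrightarrow> v = u"
      by blast
    have "(\<Sum>t\<in>{1..n}. of_bool (insert (\<beta>(i := t)) R \<subseteq> ones n k A)) =
       (\<Sum>t\<in>{1..n}. if t = u then of_bool (R \<subseteq> ones n k A) else 0 :: real)"
    proof (intro sum.cong refl)
      fix t assume t: "t \<in> {1..n}"
      have "\<beta>(i := t) \<in> ones n k A \<longleftrightarrow> t = u"
        using u positions_upd[OF assms t] t unfolding ones_def by blast
      then show "of_bool (insert (\<beta>(i := t)) R \<subseteq> ones n k A) =
        (if t = u then of_bool (R \<subseteq> ones n k A) else 0 :: real)" by simp
    qed
    also have "\<dots> = of_bool (R \<subseteq> ones n k A)" using u(1) by (simp add: sum.delta)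
    finally show ?thesis .
  qed
  then show ?thesis unfolding hit_prob_def mean_sum[symmetric] by (rule mean_cong)
qed

text \<open>Exchanging the values \<open>\<beta> i\<close> and \<open>t\<close> in coordinate
  \<open>i\<close> fixes \<open>R\<close> pointwise, because neither value occurs there, and moves
  \<open>\<beta>\<close> to \<open>\<beta>(i := t)\<close>.\<close>

lemma hit_prob_insert_move:
  assumes R: "R \<subseteq> positions n k" and \<beta>: "\<beta> \<in> positions n k" and i: "i \<in> {1..k+1}"
    and fresh: "\<beta> i \<notin> (\<lambda>\<rho>. \<rho> i) ` R" and t: "t \<in> {1..n}" "t \<notin> (\<lambda>\<rho>. \<rho> i) ` R"
  shows "hit_prob n k (insert (\<beta>(i := t)) R) = hit_prob n k (insert \<beta> R)"
proof -
  have "relabel i (\<beta> i) t \<rho> = \<rho>" if "\<rho> \<in> R" for \<rho>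
  proof -
    have "\<rho> i \<noteq> \<beta> i" "\<rho> i \<noteq> t" using that fresh t by (metis imageI)+
    then show ?thesis unfolding relabel_def by simp
  qed
  then have "relabel i (\<beta> i) t ` insert \<beta> R = insert (\<beta>(i := t)) R"
    by (simp add: relabel_def)
  then show ?thesis
    using hit_prob_relabel[OF i positions_in[OF \<beta> i] t(1), of "insert \<beta> R"] R \<beta> by simp
qed

lemma hit_prob_insert_fresh:
  assumes R: "R \<subseteq> positions n k" and \<beta>: "\<beta> \<in> positions n k" and i: "i \<in> {1..k+1}"
    and fresh: "\<beta> i \<notin> (\<lambda>\<rho>. \<rho> i) ` R" and r: "card R \<le> r" "r < n"
  shows "hit_prob n k (insert \<beta> R) \<le> hit_prob n k R / (real n - real r)"
proof -
  define T where "T = {1..n} - (\<lambda>\<rho>. \<rho> i) ` R"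
  have fin: "finite R" using R finite_positions by (rule finite_subset)
  have "card ((\<lambda>\<rho>. \<rho> i) ` R) \<le> r" using card_image_le[OF fin] r(1) by (rule le_trans)
  then have cT: "real n - real r \<le> real (card T)"
    unfolding T_def using diff_card_le_card_Diff[OF finite_imageI[OF fin], of "{1..n}"]
    by (smt (verit) card_atLeastAtMost diff_Suc_1 le_diff_conv of_nat_add of_nat_mono)
  have "real (card T) * hit_prob n k (insert \<beta> R) = (\<Sum>t\<in>T. hit_prob n k (insert (\<beta>(i := t)) R))"
    using hit_prob_insert_move[OF R \<beta> i fresh] unfolding T_def by simp
  also have "\<dots> \<le> (\<Sum>t\<in>{1..n}. hit_prob n k (insert (\<beta>(i := t)) R))"
    unfolding T_def by (intro sum_mono2) (auto simp: hit_prob_nonneg)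
  also have "\<dots> = hit_prob n k R" by (rule hit_prob_insert_sum_line[OF \<beta> i])
  finally have "real (card T) * hit_prob n k (insert \<beta> R) \<le> hit_prob n k R" .
  moreover have "(real n - real r) * hit_prob n k (insert \<beta> R) \<le> real (card T) * hit_prob n k (insert \<beta> R)"
    by (intro mult_right_mono cT hit_prob_nonneg)
  ultimately show ?thesis using r(2) by (simp add: field_simps)
qed

lemma hit_prob_singleton:
  assumes "\<alpha> \<in> positions n k"
  shows "hit_prob n k {\<alpha>} = 1 / real n"
proof -
  have i: "(1::nat) \<in> {1..k+1}" by simp
  have "real n * hit_prob n k {\<alpha>} = (\<Sum>t\<in>{1..n}. hit_prob n k (insert (\<alpha>(1 := t)) {}))"
    using hit_prob_insert_move[OF _ assms i] by simp
  also have "\<dots> = 1"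
    by (simp only: hit_prob_insert_sum_line[OF assms i] hit_prob_empty)
  \<comment> \<open>The product being 1 rules out \<open>n = 0\<close>.\<close>
  finally show ?thesis
    by (metis nonzero_eq_divide_eq mult.commute mult_zero_left zero_neq_one)
qed

lemma hit_prob_pair_le:
  assumes "\<alpha> \<in> positions n k" "\<beta> \<in> positions n k" "\<alpha> \<noteq> \<beta>" "n > 1"
  shows "hit_prob n k {\<beta>, \<alpha>} \<le> 1 / (real n * (real n - 1))"
proof -
  obtain i where i: "i \<in> {1..k+1}" "\<alpha> i \<noteq> \<beta> i"
    using positions_eqI[OF assms(1,2)] assms(3) by blast
  then show ?thesis
    using hit_prob_insert_fresh[of "{\<alpha>}" n k \<beta> i 1] assms hit_prob_singleton[OF assms(1)]
    by simp
qed

text \<open>Two differing coordinates are required: distinct positions on a common line never both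
  carry a one. The line through \<open>\<beta>\<close> in direction \<open>i\<close> carries total
  probability \<open>1 / n\<close> together with \<open>\<alpha>\<close>. Only its point with
  coordinate \<open>\<alpha> i\<close> is not equivalent to \<open>\<beta>\<close>; coordinate
  \<open>j\<close> keeps that point apart from \<open>\<alpha>\<close>, so
  \<open>hit_prob_pair_le\<close> limits its share, and the other \<open>n - 1\<close> points divide
  the rest equally.\<close>

lemma hit_prob_pair_ge:
  assumes \<alpha>: "\<alpha> \<in> positions n k" and \<beta>: "\<beta> \<in> positions n k"
    and i: "i \<in> {1..k+1}" "\<alpha> i \<noteq> \<beta> i" and j: "j \<in> {1..k+1}" "\<alpha> j \<noteq> \<beta> j"
    and ij: "i \<noteq> j" and n: "n > 1"
  shows "(real n - 2) / (real n * (real n - 1)^2) \<le> hit_prob n k {\<beta>, \<alpha>}"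
proof -
  have ai: "\<alpha> i \<in> {1..n}" using positions_in[OF \<alpha> i(1)] .
  have "\<beta>(i := \<alpha> i) \<noteq> \<alpha>" using j ij by (metis fun_upd_other)
  then have le: "hit_prob n k {\<beta>(i := \<alpha> i), \<alpha>} \<le> 1 / (real n * (real n - 1))"
    using hit_prob_pair_le[OF \<alpha> positions_upd[OF \<beta> i(1) ai] _ n] by metis
  have "1 / real n = (\<Sum>t\<in>{1..n}. hit_prob n k {\<beta>(i := t), \<alpha>})"
    using hit_prob_insert_sum_line[OF \<beta> i(1)] hit_prob_singleton[OF \<alpha>] by simp
  also have "\<dots> = hit_prob n k {\<beta>(i := \<alpha> i), \<alpha>} + (\<Sum>t\<in>{1..n} - {\<alpha> i}. hit_prob n k {\<beta>(i := t), \<alpha>})"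
    using ai by (intro sum.remove) auto
  also have "(\<Sum>t\<in>{1..n} - {\<alpha> i}. hit_prob n k {\<beta>(i := t), \<alpha>}) = (\<Sum>t\<in>{1..n} - {\<alpha> i}. hit_prob n k {\<beta>, \<alpha>})"
    using hit_prob_insert_move[of "{\<alpha>}" n k \<beta> i] \<alpha> \<beta> i by (intro sum.cong) auto
  also have "\<dots> = (real n - 1) * hit_prob n k {\<beta>, \<alpha>}"
    using ai n by (simp add: card_Diff_singleton of_nat_diff)
  finally have "1 / real n \<le> 1 / (real n * (real n - 1)) + (real n - 1) * hit_prob n k {\<beta>, \<alpha>}"
    using le by linarith
  also have "1 / (real n * (real n - 1)) = 1 / real n - (real n - 2) / (real n * (real n - 1))"
    using n by (simp add: field_simps)
  finally have "(real n - 2) / (real n * (real n - 1)) \<le> (real n - 1) * hit_prob n k {\<beta>, \<alpha>}"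
    by simp
  then have "(real n - 2) / (real n * (real n - 1)) / (real n - 1) \<le> hit_prob n k {\<beta>, \<alpha>}"
    using n by (subst pos_divide_le_eq) (auto simp: mult.commute)
  then show ?thesis by (simp add: power2_eq_square mult.assoc)
qed

subsection \<open>Moments of the number of ones in a set of positions\<close>

definition ones_in :: "nat \<Rightarrow> nat \<Rightarrow> (nat \<Rightarrow> nat) set \<Rightarrow> ((nat \<Rightarrow> nat) \<Rightarrow> nat) \<Rightarrow> real" where
  "ones_in n k F A = (\<Sum>\<alpha>\<in>F. of_bool (\<alpha> \<in> ones n k A))"

lemma mean_ones_in:
  assumes "F \<subseteq> positions n k"
  shows "mean n k (ones_in n k F) = real (card F) / real n"
proof -
  have "mean n k (ones_in n k F) = (\<Sum>\<alpha>\<in>F. hit_prob n k {\<alpha>})"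
    unfolding ones_in_def hit_prob_def mean_sum by simp
  also have "\<dots> = (\<Sum>\<alpha>\<in>F. 1 / real n)"
    using assms by (intro sum.cong refl hit_prob_singleton) blast
  finally show ?thesis by simp
qed

lemma mean_ones_in_square:
  "mean n k (\<lambda>A. (ones_in n k F A)^2) = (\<Sum>\<alpha>\<in>F. \<Sum>\<beta>\<in>F. hit_prob n k {\<beta>, \<alpha>})"
proof -
  have "(ones_in n k F A)^2 = (\<Sum>\<alpha>\<in>F. \<Sum>\<beta>\<in>F. of_bool ({\<beta>, \<alpha>} \<subseteq> ones n k A))" for A
    unfolding ones_in_def power2_eq_square sum_product
    by (intro sum.cong refl) auto
  then show ?thesis unfolding hit_prob_def by (simp add: mean_sum)
qed

lemma mean_ones_in_four:
  "mean n k (\<lambda>A. (ones_in n k F A)^2 * (ones_in n k G A)^2) =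
    (\<Sum>\<alpha>\<in>F. \<Sum>\<beta>\<in>F. \<Sum>\<gamma>\<in>G. \<Sum>\<delta>\<in>G. hit_prob n k {\<delta>, \<gamma>, \<beta>, \<alpha>})"
proof -
  have "(ones_in n k F A)^2 * (ones_in n k G A)^2 =
     (\<Sum>\<alpha>\<in>F. \<Sum>\<beta>\<in>F. \<Sum>\<gamma>\<in>G. \<Sum>\<delta>\<in>G. of_bool ({\<delta>, \<gamma>, \<beta>, \<alpha>} \<subseteq> ones n k A))" for A
  proof -
    have *: "(\<Sum>\<alpha>\<in>F. \<Sum>\<beta>\<in>F. f \<alpha> \<beta>) * (\<Sum>\<gamma>\<in>G. \<Sum>\<delta>\<in>G. g \<gamma> \<delta>) =
      (\<Sum>\<alpha>\<in>F. \<Sum>\<beta>\<in>F. \<Sum>\<gamma>\<in>G. \<Sum>\<delta>\<in>G. f \<alpha> \<beta> * g \<gamma> \<delta>)" for f g :: "_ \<Rightarrow> _ \<Rightarrow> real"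
      by (simp only: sum_distrib_right) (simp only: sum_distrib_left)
    have sq: "(ones_in n k H A)^2 =
        (\<Sum>\<alpha>\<in>H. \<Sum>\<beta>\<in>H. of_bool (\<alpha> \<in> ones n k A) * of_bool (\<beta> \<in> ones n k A))" for H
      unfolding ones_in_def power2_eq_square by (rule sum_product)
    show ?thesis unfolding sq *
      by (intro sum.cong refl) auto
  qed
  then show ?thesis unfolding hit_prob_def by (simp add: mean_sum)
qed

text \<open>The positions with no coordinate in which they can be moved without disturbing
  \<open>R\<close>; for these only the trivial bound \<open>hit_prob n k R\<close> is left.\<close>

definition covered :: "nat \<Rightarrow> (nat \<Rightarrow> nat) set \<Rightarrow> (nat \<Rightarrow> nat) \<Rightarrow> bool" where
  "covered k R \<gamma> \<longleftrightarrow> (\<forall>i\<in>{1..k+1}. \<gamma> i \<in> (\<lambda>\<rho>. \<rho> i) ` R)"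

text \<open>An uncovered position costs a factor \<open>1 / (n - r)\<close>, a covered one at most
  1. Applied to the innermost index again and again, this evaluates moment sums one summation at a
  time.\<close>

lemma sum_hit_prob_insert_le:
  assumes F: "F \<subseteq> positions n k" and R: "R \<subseteq> positions n k" and r: "card R \<le> r" "r < n"
    and c: "card {\<gamma>\<in>F. covered k R \<gamma>} \<le> c"
  shows "(\<Sum>\<gamma>\<in>F. hit_prob n k (insert \<gamma> R))
    \<le> hit_prob n k R * (real c + real (card F) / (real n - real r))"
proof -
  have fin: "finite F" using F finite_positions by (rule finite_subset)
  have "(\<Sum>\<gamma>\<in>F. hit_prob n k (insert \<gamma> R)) \<le>
     (\<Sum>\<gamma>\<in>F. hit_prob n k R * of_bool (covered k R \<gamma>) + hit_prob n k R / (real n - real r))"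
  proof (rule sum_mono)
    fix \<gamma> assume g: "\<gamma> \<in> F"
    show "hit_prob n k (insert \<gamma> R) \<le>
       hit_prob n k R * of_bool (covered k R \<gamma>) + hit_prob n k R / (real n - real r)"
    proof (cases "covered k R \<gamma>")
      case True
      have "hit_prob n k (insert \<gamma> R) \<le> hit_prob n k R" by (rule hit_prob_antimono) blast
      moreover have "0 \<le> hit_prob n k R / (real n - real r)"
        using r(2) by (intro divide_nonneg_pos hit_prob_nonneg) simp
      ultimately show ?thesis using True by simp
    next
      case False
      then obtain i where "i \<in> {1..k+1}" "\<gamma> i \<notin> (\<lambda>\<rho>. \<rho> i) ` R" unfolding covered_def by blast
      then have "hit_prob n k (insert \<gamma> R) \<le> hit_prob n k R / (real n - real r)"
        using hit_prob_insert_fresh[OF R _ _ _ r] F g by blast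
      then show ?thesis using False by simp
    qed
  qed
  also have "\<dots> = hit_prob n k R * (real (card {\<gamma>\<in>F. covered k R \<gamma>}) + real (card F) / (real n - real r))"
    using fin by (simp add: sum.distrib sum_distrib_left[symmetric] distrib_left of_bool_def
        sum.If_cases Int_def)
  also have "\<dots> \<le> hit_prob n k R * (real c + real (card F) / (real n - real r))"
    using c by (intro mult_left_mono add_right_mono hit_prob_nonneg) simp
  finally show ?thesis .
qed

text \<open>Each of the \<open>k + 1\<close> coordinates has at most \<open>card R\<close> choices,
  a bound that does not grow with \<open>n\<close>.\<close>

lemma card_covered_le:
  assumes R: "finite R" and F: "F \<subseteq> positions n k"
  shows "card {\<gamma>\<in>F. covered k R \<gamma>} \<le> card R ^ (k + 1)"
proof -
  have "{\<gamma>\<in>F. covered k R \<gamma>} \<subseteq> (\<Pi>\<^sub>E i\<in>{1..k+1}. (\<lambda>\<rho>. \<rho> i) ` R)"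
    using F unfolding covered_def positions_def by (auto simp: PiE_iff)
  then have "card {\<gamma>\<in>F. covered k R \<gamma>} \<le> card (\<Pi>\<^sub>E i\<in>{1..k+1}. (\<lambda>\<rho>. \<rho> i) ` R)"
    by (intro card_mono finite_PiE finite_imageI R) auto
  also have "\<dots> = (\<Prod>i\<in>{1..k+1}. card ((\<lambda>\<rho>. \<rho> i) ` R))" by (rule card_PiE) simp
  also have "\<dots> \<le> (\<Prod>i\<in>{1..k+1}. card R)" by (intro prod_mono conjI card_image_le R) simp
  finally show ?thesis by simp
qed

lemma sum_hit_prob_pair_le:
  assumes F: "F \<subseteq> positions n k" and n: "n > 1"
  shows "(\<Sum>\<alpha>\<in>F. \<Sum>\<beta>\<in>F. hit_prob n k {\<beta>, \<alpha>})
    \<le> real (card F) / real n * (1 + real (card F) / (real n - 1))"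
proof -
  have "(\<Sum>\<alpha>\<in>F. \<Sum>\<beta>\<in>F. hit_prob n k {\<beta>, \<alpha>})
    \<le> (\<Sum>\<alpha>\<in>F. hit_prob n k {\<alpha>} * (real 1 + real (card F) / (real n - real 1)))"
  proof (intro sum_mono sum_hit_prob_insert_le F)
    fix \<alpha> assume "\<alpha> \<in> F"
    then show "{\<alpha>} \<subseteq> positions n k" using F by blast
    show "card {\<gamma>\<in>F. covered k {\<alpha>} \<gamma>} \<le> 1" using card_covered_le[of "{\<alpha>}", OF _ F] by simp
  qed (use n in auto)
  also have "\<dots> = (\<Sum>\<alpha>\<in>F. 1 / real n * (1 + real (card F) / (real n - 1)))"
    using F by (intro sum.cong refl) (use hit_prob_singleton in auto)
  finally show ?thesis by simp
qed

lemma mean_ones_in_square_le: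
  assumes "F \<subseteq> positions n k" "n > 1"
  shows "mean n k (\<lambda>A. (ones_in n k F A)^2)
    \<le> real (card F) / real n * (1 + real (card F) / (real n - 1))"
  unfolding mean_ones_in_square by (rule sum_hit_prob_pair_le[OF assms])

text \<open>Serves for a box paired with itself. Only \<open>N\<close> of the
  \<open>N\<^sup>2\<close> pairs of boxes are of this kind, so any bound that stays bounded when
  \<open>card F\<close> is of order \<open>n\<close> will do; each peeled summation costs the factor
  \<open>c\<close>.\<close>

lemma mean_ones_in_fourth_le:
  assumes F: "F \<subseteq> positions n k" and n: "n > 3"
  shows "mean n k (\<lambda>A. (ones_in n k F A)^2 * (ones_in n k F A)^2)
    \<le> real (card F) / real n * (3 ^ (k + 1) + real (card F) / (real n - 3)) ^ 3"
proof -
  define c where "c = 3 ^ (k + 1) + real (card F) / (real n - 3)"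
  have c0: "0 \<le> c" unfolding c_def using n by simp
  have step: "(\<Sum>\<gamma>\<in>F. hit_prob n k (insert \<gamma> R)) \<le> hit_prob n k R * c"
    if R: "R \<subseteq> F" "card R \<le> 3" for R
  proof -
    have fin: "finite R" using R(1) F finite_positions by (metis finite_subset)
    have "card {\<gamma>\<in>F. covered k R \<gamma>} \<le> 3 ^ (k + 1)"
      using card_covered_le[OF fin F] power_mono[OF R(2), of "k + 1"] by linarith
    then show ?thesis
      using sum_hit_prob_insert_le[OF F _ R(2) _, of "3 ^ (k + 1)"] R F n unfolding c_def by auto
  qed
  have "mean n k (\<lambda>A. (ones_in n k F A)^2 * (ones_in n k F A)^2) =
     (\<Sum>\<alpha>\<in>F. \<Sum>\<beta>\<in>F. \<Sum>\<gamma>\<in>F. \<Sum>\<delta>\<in>F. hit_prob n k {\<delta>, \<gamma>, \<beta>, \<alpha>})"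
    by (rule mean_ones_in_four)
  also have "\<dots> \<le> (\<Sum>\<alpha>\<in>F. \<Sum>\<beta>\<in>F. \<Sum>\<gamma>\<in>F. hit_prob n k {\<gamma>, \<beta>, \<alpha>} * c)"
    by (intro sum_mono step) (auto simp: card_insert_if)
  also have "\<dots> = (\<Sum>\<alpha>\<in>F. \<Sum>\<beta>\<in>F. (\<Sum>\<gamma>\<in>F. hit_prob n k {\<gamma>, \<beta>, \<alpha>}) * c)"
    by (simp add: sum_distrib_right)
  also have "\<dots> \<le> (\<Sum>\<alpha>\<in>F. \<Sum>\<beta>\<in>F. hit_prob n k {\<beta>, \<alpha>} * c * c)"
    by (intro sum_mono mult_right_mono step c0) (auto simp: card_insert_if)
  also have "\<dots> = (\<Sum>\<alpha>\<in>F. (\<Sum>\<beta>\<in>F. hit_prob n k {\<beta>, \<alpha>}) * c * c)"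
    by (simp add: sum_distrib_right)
  also have "\<dots> \<le> (\<Sum>\<alpha>\<in>F. hit_prob n k {\<alpha>} * c * c * c)"
    by (intro sum_mono mult_right_mono step c0) auto
  also have "\<dots> = (\<Sum>\<alpha>\<in>F. 1 / real n * c * c * c)"
    using F by (intro sum.cong refl) (use hit_prob_singleton in auto)
  finally show ?thesis unfolding c_def[symmetric] by (simp add: power3_eq_cube mult.assoc)
qed

text \<open>Here the leading order must be exact: when both sets have about C n elements, the bound
  tends to (C + C^2)^2, the square of the limiting second moment, which makes the variance vanish.
  This works because \<open>F\<close> and \<open>G\<close> share no coordinate value: given two
  positions of \<open>F\<close>, no position of \<open>G\<close> is covered, and after one of
  \<open>G\<close> is added, only that one is.\<close>

lemma mean_ones_in_disjoint_le:
  assumes F: "F \<subseteq> positions n k" and G: "G \<subseteq> positions n k" and n: "n > 3"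
    and disj: "\<And>\<alpha> \<gamma> i. \<alpha> \<in> F \<Longrightarrow> \<gamma> \<in> G \<Longrightarrow> i \<in> {1..k+1} \<Longrightarrow> \<alpha> i \<noteq> \<gamma> i"
  shows "mean n k (\<lambda>A. (ones_in n k F A)^2 * (ones_in n k G A)^2)
    \<le> real (card F) / real n * (1 + real (card F) / (real n - 1))
      * (real (card G) / (real n - 2)) * (1 + real (card G) / (real n - 3))"
proof -
  define a where "a = real (card G) / (real n - 2)"
  define b where "b = 1 + real (card G) / (real n - 3)"
  have ab: "0 \<le> a" "0 \<le> b" unfolding a_def b_def using n by simp_all
  have b: "(\<Sum>\<delta>\<in>G. hit_prob n k {\<delta>, \<gamma>, \<beta>, \<alpha>}) \<le> hit_prob n k {\<gamma>, \<beta>, \<alpha>} * b"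
    if m: "\<alpha> \<in> F" "\<beta> \<in> F" "\<gamma> \<in> G" for \<alpha> \<beta> \<gamma>
  proof -
    have "\<delta> = \<gamma>" if d: "\<delta> \<in> G" "covered k {\<gamma>, \<beta>, \<alpha>} \<delta>" for \<delta>
    proof (rule positions_eqI[of \<delta> n k])
      fix i assume i: "i \<in> {1..k+1}"
      have "\<delta> i \<in> {\<gamma> i, \<beta> i, \<alpha> i}" using d(2) i unfolding covered_def by auto
      then show "\<delta> i = \<gamma> i" using disj[OF m(1) d(1) i] disj[OF m(2) d(1) i] by auto
    qed (use d m G in auto)
    then have "{\<delta>\<in>G. covered k {\<gamma>, \<beta>, \<alpha>} \<delta>} \<subseteq> {\<gamma>}" by blast
    then have "card {\<delta>\<in>G. covered k {\<gamma>, \<beta>, \<alpha>} \<delta>} \<le> 1"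
      using card_mono[of "{\<gamma>}"] by fastforce
    moreover have "card {\<gamma>, \<beta>, \<alpha>} \<le> 3" by (auto simp: card_insert_if)
    ultimately show ?thesis
      using sum_hit_prob_insert_le[OF G, of "{\<gamma>, \<beta>, \<alpha>}" 3 1] m F G n unfolding b_def by auto
  qed
  have a: "(\<Sum>\<gamma>\<in>G. hit_prob n k {\<gamma>, \<beta>, \<alpha>}) \<le> hit_prob n k {\<beta>, \<alpha>} * a"
    if m: "\<alpha> \<in> F" "\<beta> \<in> F" for \<alpha> \<beta>
  proof -
    have "\<not> covered k {\<beta>, \<alpha>} \<gamma>" if g: "\<gamma> \<in> G" for \<gamma>
      using disj[OF m(1) g, of 1] disj[OF m(2) g, of 1] unfolding covered_def by force
    then have "{\<gamma>\<in>G. covered k {\<beta>, \<alpha>} \<gamma>} = {}" by blast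
    then have "card {\<gamma>\<in>G. covered k {\<beta>, \<alpha>} \<gamma>} \<le> 0" by (simp only: card.empty)
    moreover have "card {\<beta>, \<alpha>} \<le> 2" by (auto simp: card_insert_if)
    ultimately show ?thesis
      using sum_hit_prob_insert_le[OF G, of "{\<beta>, \<alpha>}" 2 0] m F G n unfolding a_def by auto
  qed
  have "mean n k (\<lambda>A. (ones_in n k F A)^2 * (ones_in n k G A)^2) =
     (\<Sum>\<alpha>\<in>F. \<Sum>\<beta>\<in>F. \<Sum>\<gamma>\<in>G. \<Sum>\<delta>\<in>G. hit_prob n k {\<delta>, \<gamma>, \<beta>, \<alpha>})"
    by (rule mean_ones_in_four)
  also have "\<dots> \<le> (\<Sum>\<alpha>\<in>F. \<Sum>\<beta>\<in>F. \<Sum>\<gamma>\<in>G. hit_prob n k {\<gamma>, \<beta>, \<alpha>} * b)"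
    by (intro sum_mono b)
  also have "\<dots> = (\<Sum>\<alpha>\<in>F. \<Sum>\<beta>\<in>F. (\<Sum>\<gamma>\<in>G. hit_prob n k {\<gamma>, \<beta>, \<alpha>}) * b)"
    by (simp add: sum_distrib_right)
  also have "\<dots> \<le> (\<Sum>\<alpha>\<in>F. \<Sum>\<beta>\<in>F. hit_prob n k {\<beta>, \<alpha>} * a * b)"
    by (intro sum_mono mult_right_mono a ab)
  also have "\<dots> = (\<Sum>\<alpha>\<in>F. \<Sum>\<beta>\<in>F. hit_prob n k {\<beta>, \<alpha>}) * a * b"
    by (simp add: sum_distrib_right)
  also have "\<dots> \<le> real (card F) / real n * (1 + real (card F) / (real n - 1)) * a * b"
    using n by (intro mult_right_mono ab sum_hit_prob_pair_le F) auto
  finally show ?thesis unfolding a_def b_def .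
qed

subsection \<open>Diagonal boxes\<close>

definition box :: "nat \<Rightarrow> nat \<Rightarrow> nat \<Rightarrow> (nat \<Rightarrow> nat) set" where
  "box k s i = {1..k+1} \<rightarrow>\<^sub>E {i * s + 1..i * s + s}"

lemma card_box: "card (box k s i) = s ^ (k + 1)"
  unfolding box_def by (simp add: card_PiE)

lemma finite_box: "finite (box k s i)"
  unfolding box_def by (intro finite_PiE) auto

lemma box_in: "\<alpha> \<in> box k s i \<Longrightarrow> j \<in> {1..k+1} \<Longrightarrow> \<alpha> j \<in> {i * s + 1..i * s + s}"
  unfolding box_def by (rule PiE_mem)

lemma box_subset:
  assumes "i < N" "N * s \<le> n"
  shows "box k s i \<subseteq> positions n k"
proof -
  have "Suc i * s \<le> N * s" using assms(1) by (intro mult_right_mono) auto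
  then have "i * s + s \<le> n" using assms(2) by simp
  then show ?thesis unfolding box_def positions_def by (intro PiE_mono) auto
qed

lemma box_less:
  assumes "i < i'" "\<alpha> \<in> box k s i" "\<beta> \<in> box k s i'" "j \<in> {1..k+1}"
  shows "\<alpha> j < \<beta> j"
proof -
  have "Suc i * s \<le> i' * s" using assms(1) by (intro mult_right_mono) auto
  then show ?thesis using box_in[OF assms(2,4)] box_in[OF assms(3,4)] by simp
qed

lemma box_disjoint_coord:
  assumes "i \<noteq> i'" "\<alpha> \<in> box k s i" "\<beta> \<in> box k s i'" "j \<in> {1..k+1}"
  shows "\<alpha> j \<noteq> \<beta> j"
  using box_less[of i i'] box_less[of i' i] assms by (metis less_irrefl nat_neq_iff)

lemma longest_monotone_ge:
  assumes "monotone_subseq n k A m s"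
  shows "m \<le> longest_monotone n k A"
  unfolding longest_monotone_def using assms finite_monotone_subseq_lengths
  by (intro Max_ge) auto

lemma longest_monotone_ge_boxes:
  assumes I: "I \<subseteq> {..<N}" and hit: "\<And>i. i \<in> I \<Longrightarrow> box k s i \<inter> ones n k A \<noteq> {}"
  shows "card I \<le> longest_monotone n k A"
proof -
  have fin: "finite I" using I by (rule finite_subset) simp
  have "\<forall>i\<in>I. \<exists>x. x \<in> box k s i \<inter> ones n k A" using hit by blast
  then obtain p where "\<forall>i\<in>I. p i \<in> box k s i \<inter> ones n k A" by (rule bchoice[THEN exE])
  then have p: "p i \<in> box k s i" "p i \<in> ones n k A" if "i \<in> I" for i using that by auto
  \<comment> \<open>The terms of \<open>monotone_subseq\<close> are numbered from 1, list entries
    from 0.\<close>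
  define e where "e = (\<lambda>m. sorted_list_of_set I ! (m - 1))"
  have eI: "e m \<in> I" if "m \<in> {1..card I}" for m
  proof -
    have "m - 1 < length (sorted_list_of_set I)" using that by auto
    then show ?thesis unfolding e_def using fin nth_mem by (metis set_sorted_list_of_set)
  qed
  have eless: "e m < e m'" if "m \<in> {1..card I}" "m' \<in> {1..card I}" "m < m'" for m m'
    unfolding e_def using that
    by (intro sorted_wrt_nth_less[OF strict_sorted_list_of_set]) auto
  have "monotone_subseq n k A (card I) (\<lambda>m. p (e m))"
    unfolding monotone_subseq_def
  proof (intro conjI ballI disjI1 monotone_onI)
    fix j m m' assume j: "j \<in> {1..k+1}" and m: "m \<in> {1..card I}" "m' \<in> {1..card I}" "m < m'"
    show "p (e m) j < p (e m') j"
      by (rule box_less[OF eless[OF m] p(1)[OF eI[OF m(1)]] p(1)[OF eI[OF m(2)]] j])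
  qed (use p(2) eI in blast)
  then show ?thesis by (rule longest_monotone_ge)
qed

text \<open>The quadratic is \<open>1 - (1 - a X)\<^sup>2\<close> for the number \<open>X\<close> of ones in the box, so it is at most
  the indicator of \<open>X > 0\<close>.\<close>

lemma longest_monotone_ge_quadratic:
  "(\<Sum>i<N. 2 * a * ones_in n k (box k s i) A - a^2 * (ones_in n k (box k s i) A)^2)
    \<le> real (longest_monotone n k A)"
proof -
  define I where "I = {i\<in>{..<N}. box k s i \<inter> ones n k A \<noteq> {}}"
  have "(\<Sum>i<N. 2 * a * ones_in n k (box k s i) A - a^2 * (ones_in n k (box k s i) A)^2)
     \<le> (\<Sum>i<N. of_bool (box k s i \<inter> ones n k A \<noteq> {}))"
  proof (rule sum_mono)
    fix i
    define X where "X = ones_in n k (box k s i) A"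
    show "2 * a * X - a^2 * X^2 \<le> of_bool (box k s i \<inter> ones n k A \<noteq> {})"
    proof (cases "box k s i \<inter> ones n k A = {}")
      case True
      then have "X = 0" unfolding X_def ones_in_def by (intro sum.neutral) auto
      then show ?thesis by simp
    next
      case False
      have "0 \<le> (1 - a * X)^2" by simp
      then show ?thesis using False by (simp add: power2_eq_square algebra_simps)
    qed
  qed
  also have "\<dots> = real (card I)"
    unfolding I_def by (simp add: of_bool_def sum.If_cases Int_def)
  also have "\<dots> \<le> real (longest_monotone n k A)"
    by (intro of_nat_mono longest_monotone_ge_boxes[of I N k s]) (auto simp: I_def)
  finally show ?thesis .
qed

text \<open>The set consists of \<open>\<alpha>\<close> and the positions on a common line with it,
  to which \<open>hit_prob_pair_ge\<close> does not apply. For \<open>k \<ge> 1\<close> and large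
  \<open>s\<close> its size is negligible against the volume \<open>s ^ (k + 1)\<close>.\<close>

lemma card_box_near:
  assumes "\<alpha> \<in> box k s i"
  shows "card {\<beta>\<in>box k s i. \<exists>j\<in>{1..k+1}. \<forall>l\<in>{1..k+1} - {j}. \<beta> l = \<alpha> l} \<le> (k + 1) * s"
proof -
  have "{\<beta>\<in>box k s i. \<exists>j\<in>{1..k+1}. \<forall>l\<in>{1..k+1} - {j}. \<beta> l = \<alpha> l} \<subseteq>
     (\<Union>j\<in>{1..k+1}. (\<lambda>t. \<alpha>(j := t)) ` {i * s + 1..i * s + s})"
  proof
    fix \<beta> assume "\<beta> \<in> {\<beta>\<in>box k s i. \<exists>j\<in>{1..k+1}. \<forall>l\<in>{1..k+1} - {j}. \<beta> l = \<alpha> l}"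
    then obtain j where b: "\<beta> \<in> box k s i" and j: "j \<in> {1..k+1}"
      and eq: "\<And>l. l \<in> {1..k+1} - {j} \<Longrightarrow> \<beta> l = \<alpha> l" by blast
    have "\<beta> l = (\<alpha>(j := \<beta> j)) l" for l
      using b assms eq[of l] j unfolding box_def by (cases "l \<in> {1..k+1}") (auto simp: PiE_iff extensional_def)
    then have "\<beta> = \<alpha>(j := \<beta> j)" by blast
    then show "\<beta> \<in> (\<Union>j\<in>{1..k+1}. (\<lambda>t. \<alpha>(j := t)) ` {i * s + 1..i * s + s})"
      using box_in[OF b j] j by blast
  qed
  then have "card {\<beta>\<in>box k s i. \<exists>j\<in>{1..k+1}. \<forall>l\<in>{1..k+1} - {j}. \<beta> l = \<alpha> l} \<le>
     card (\<Union>j\<in>{1..k+1}. (\<lambda>t. \<alpha>(j := t)) ` {i * s + 1..i * s + s})"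
    by (intro card_mono) auto
  also have "\<dots> \<le> (\<Sum>j\<in>{1..k+1}. card ((\<lambda>t. \<alpha>(j := t)) ` {i * s + 1..i * s + s}))"
    by (rule card_UN_le) simp
  also have "\<dots> \<le> (\<Sum>j\<in>{1..k+1}. card {i * s + 1..i * s + s})"
    by (intro sum_mono card_image_le) simp
  also have "\<dots> = (k + 1) * s" by simp
  finally show ?thesis .
qed

text \<open>Each \<open>\<alpha>\<close> contributes \<open>1 / n\<close> with itself and at least
  \<open>q\<close> with every position differing from it in two coordinates; the remaining pairs are
  dropped. When the volume is about C n and the side is o(n), the bound tends to C + C^2.\<close>

lemma mean_ones_in_box_square_ge:
  assumes sub: "box k s i \<subseteq> positions n k" and n: "n > 1"
  shows "real (s ^ (k + 1)) / real n + real (s ^ (k + 1)) *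
      (real (s ^ (k + 1)) - (real k + 1) * real s) * ((real n - 2) / (real n * (real n - 1)^2))
    \<le> mean n k (\<lambda>A. (ones_in n k (box k s i) A)^2)"
proof -
  define q where "q = (real n - 2) / (real n * (real n - 1)^2)"
  have q0: "0 \<le> q" unfolding q_def using n by simp
  let ?F = "box k s i"
  have "1 / real n + (real (s ^ (k + 1)) - (real k + 1) * real s) * q
      \<le> (\<Sum>\<beta>\<in>?F. hit_prob n k {\<beta>, \<alpha>})" if \<alpha>: "\<alpha> \<in> ?F" for \<alpha>
  proof -
    define S where "S = {\<beta>\<in>?F. \<exists>j\<in>{1..k+1}. \<forall>l\<in>{1..k+1} - {j}. \<beta> l = \<alpha> l}"
    have S: "S \<subseteq> ?F" "\<alpha> \<in> S" "card S \<le> (k + 1) * s" "finite S"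
      using \<alpha> card_box_near[OF \<alpha>] finite_box[of k s i] unfolding S_def by auto
    have far: "q \<le> hit_prob n k {\<beta>, \<alpha>}" if b: "\<beta> \<in> ?F - S" for \<beta>
    proof -
      \<comment> \<open>Not being in \<open>S\<close> is used twice: at direction 1 it gives a
        differing coordinate \<open>i'\<close>, and at direction \<open>i'\<close> a second
        one.\<close>
      have "1 \<in> {1..k+1}" by simp
      then obtain i' where i': "i' \<in> {1..k+1}" "\<beta> i' \<noteq> \<alpha> i'" using b unfolding S_def by blast
      then obtain j where "j \<in> {1..k+1}" "\<beta> j \<noteq> \<alpha> j" "j \<noteq> i'" using b unfolding S_def by blast
      then show ?thesis unfolding q_def
        using hit_prob_pair_ge[of \<alpha> n k \<beta> i' j] i' \<alpha> b sub n by auto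
    qed
    have "(real (s ^ (k + 1)) - (real k + 1) * real s) * q \<le> (real (s ^ (k + 1)) - real (card S)) * q"
    proof (rule mult_right_mono)
      have "real (card S) \<le> real ((k + 1) * s)" using S(3) by linarith
      then show "real (s ^ (k + 1)) - (real k + 1) * real s \<le> real (s ^ (k + 1)) - real (card S)"
        by (simp add: algebra_simps)
    qed (rule q0)
    also have "\<dots> = real (card (?F - S)) * q"
      using S card_mono[OF finite_box S(1)] by (simp add: card_Diff_subset card_box of_nat_diff del: power_Suc)
    also have "\<dots> \<le> (\<Sum>\<beta>\<in>?F - S. hit_prob n k {\<beta>, \<alpha>})"
      using sum_mono[of "?F - S" "\<lambda>_. q" "\<lambda>\<beta>. hit_prob n k {\<beta>, \<alpha>}"] far by simp
    finally have far': "(real (s ^ (k + 1)) - (real k + 1) * real s) * q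
       \<le> (\<Sum>\<beta>\<in>?F - S. hit_prob n k {\<beta>, \<alpha>})" .
    have "1 / real n = (\<Sum>\<beta>\<in>{\<alpha>}. hit_prob n k {\<beta>, \<alpha>})"
      using hit_prob_singleton[of \<alpha> n k] \<alpha> sub by auto
    also have "\<dots> \<le> (\<Sum>\<beta>\<in>S. hit_prob n k {\<beta>, \<alpha>})"
      using S by (intro sum_mono2 hit_prob_nonneg) auto
    finally have "1 / real n \<le> (\<Sum>\<beta>\<in>S. hit_prob n k {\<beta>, \<alpha>})" .
    with far' show ?thesis
      using sum.subset_diff[OF S(1) finite_box, of "\<lambda>\<beta>. hit_prob n k {\<beta>, \<alpha>}"] by linarith
  qed
  then have "(\<Sum>\<alpha>\<in>?F. 1 / real n + (real (s ^ (k + 1)) - (real k + 1) * real s) * q)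
      \<le> (\<Sum>\<alpha>\<in>?F. \<Sum>\<beta>\<in>?F. hit_prob n k {\<beta>, \<alpha>})"
    by (rule sum_mono)
  then show ?thesis
    unfolding mean_ones_in_square q_def[symmetric] sum_constant card_box by (simp add: algebra_simps)
qed

section \<open>Sums over all boxes and their first two moments\<close>

definition total_ones :: "nat \<Rightarrow> nat \<Rightarrow> nat \<Rightarrow> nat \<Rightarrow> ((nat \<Rightarrow> nat) \<Rightarrow> nat) \<Rightarrow> real" where
  "total_ones n k s N A = (\<Sum>i<N. ones_in n k (box k s i) A)"

definition total_squares :: "nat \<Rightarrow> nat \<Rightarrow> nat \<Rightarrow> nat \<Rightarrow> ((nat \<Rightarrow> nat) \<Rightarrow> nat) \<Rightarrow> real" where
  "total_squares n k s N A = (\<Sum>i<N. (ones_in n k (box k s i) A)^2)"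

lemma longest_monotone_ge_totals:
  "2 * a * total_ones n k s N A - a^2 * total_squares n k s N A \<le> real (longest_monotone n k A)"
  using longest_monotone_ge_quadratic[where N = N and a = a and n = n and k = k and s = s and A = A]
  unfolding total_ones_def total_squares_def by (simp add: sum_subtractf sum_distrib_left)

lemma mean_total_ones:
  assumes "N * s \<le> n"
  shows "mean n k (total_ones n k s N) = real N * (real (s ^ (k + 1)) / real n)"
proof -
  have "mean n k (total_ones n k s N) = (\<Sum>i<N. mean n k (ones_in n k (box k s i)))"
    unfolding total_ones_def mean_sum by simp
  also have "\<dots> = (\<Sum>i<N. real (s ^ (k + 1)) / real n)"
    by (intro sum.cong refl) (simp add: mean_ones_in[OF box_subset[OF _ assms]] card_box)
  finally show ?thesis by simp
qed

text \<open>The boxes are disjoint, so the total is the number of ones in their union, and the bound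
  for a single set applies to that union.\<close>

lemma mean_total_ones_square_le:
  assumes N: "N * s \<le> n" and n: "n > 1"
  shows "mean n k (\<lambda>A. (total_ones n k s N A)^2) \<le>
    real N * (real (s ^ (k + 1)) / real n) * (1 + real N * real (s ^ (k + 1)) / (real n - 1))"
proof -
  define U where "U = (\<Union>i<N. box k s i)"
  have disj: "box k s i \<inter> box k s i' = {}" if "i \<noteq> i'" for i i'
    using box_disjoint_coord[OF that, of _ k s _ 1] by force
  have U: "U \<subseteq> positions n k" unfolding U_def using box_subset[OF _ N] by blast
  have card: "card U = N * s ^ (k + 1)"
    unfolding U_def using disj by (subst card_UN_disjoint) (auto simp: finite_box card_box)
  have "total_ones n k s N A = ones_in n k U A" for A
    unfolding total_ones_def ones_in_def U_def using disj
    by (intro sum.UNION_disjoint[symmetric]) (auto simp: finite_box)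
  then show ?thesis using mean_ones_in_square_le[OF U n] unfolding card by simp
qed

lemma mean_total_squares_le:
  assumes N: "N * s \<le> n" and n: "n > 1"
  shows "mean n k (total_squares n k s N) \<le>
    real N * (real (s ^ (k + 1)) / real n * (1 + real (s ^ (k + 1)) / (real n - 1)))"
proof -
  have "mean n k (total_squares n k s N) = (\<Sum>i<N. mean n k (\<lambda>A. (ones_in n k (box k s i) A)^2))"
    unfolding total_squares_def mean_sum by simp
  also have "\<dots> \<le> (\<Sum>i<N. real (s ^ (k + 1)) / real n * (1 + real (s ^ (k + 1)) / (real n - 1)))"
    by (intro sum_mono) (metis mean_ones_in_square_le[OF box_subset[OF _ N] n] card_box lessThan_iff)
  finally show ?thesis by simp
qed

lemma mean_total_squares_ge:
  assumes N: "N * s \<le> n" and n: "n > 1"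
  shows "real N * (real (s ^ (k + 1)) / real n + real (s ^ (k + 1)) *
      (real (s ^ (k + 1)) - (real k + 1) * real s) * ((real n - 2) / (real n * (real n - 1)^2)))
    \<le> mean n k (total_squares n k s N)"
proof -
  have "(\<Sum>i<N. real (s ^ (k + 1)) / real n + real (s ^ (k + 1)) *
      (real (s ^ (k + 1)) - (real k + 1) * real s) * ((real n - 2) / (real n * (real n - 1)^2)))
     \<le> (\<Sum>i<N. mean n k (\<lambda>A. (ones_in n k (box k s i) A)^2))"
    by (intro sum_mono mean_ones_in_box_square_ge box_subset[OF _ N] n) simp
  also have "\<dots> = mean n k (total_squares n k s N)"
    unfolding total_squares_def mean_sum by simp
  finally show ?thesis by simp
qed

lemma mean_total_squares_square_le:
  fixes n k s N :: nat
  defines "\<mu> \<equiv> real (s ^ (k + 1))"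
  assumes N: "N * s \<le> n" and n: "n > 3"
  shows "mean n k (\<lambda>A. (total_squares n k s N A)^2) \<le>
    real N * (\<mu> / real n * (3 ^ (k + 1) + \<mu> / (real n - 3)) ^ 3) +
    (real N)^2 * (\<mu> / real n * (1 + \<mu> / (real n - 1)) * (\<mu> / (real n - 2)) * (1 + \<mu> / (real n - 3)))"
proof -
  define c where "c = \<mu> / real n * (3 ^ (k + 1) + \<mu> / (real n - 3)) ^ 3"
  define d where "d = \<mu> / real n * (1 + \<mu> / (real n - 1)) * (\<mu> / (real n - 2)) * (1 + \<mu> / (real n - 3))"
  let ?X = "\<lambda>i A. ones_in n k (box k s i) A"
  have cd: "0 \<le> c" "0 \<le> d" unfolding c_def d_def \<mu>_def using n by simp_all
  have sub: "box k s i \<subseteq> positions n k" if "i < N" for i using box_subset[OF that N] .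
  have "(total_squares n k s N A)^2 = (\<Sum>i<N. \<Sum>j<N. (?X i A)^2 * (?X j A)^2)" for A
    unfolding total_squares_def power2_eq_square[of "sum _ _"] by (rule sum_product)
  then have "mean n k (\<lambda>A. (total_squares n k s N A)^2)
     = (\<Sum>i<N. \<Sum>j<N. mean n k (\<lambda>A. (?X i A)^2 * (?X j A)^2))"
    by (simp add: mean_sum)
  \<comment> \<open>Adding \<open>d\<close> to the equal pairs as well is harmless in an upper bound
    and makes the double sum evaluate at once.\<close>
  also have "\<dots> \<le> (\<Sum>i<N. \<Sum>j<N. (if j = i then c else 0) + d)"
  proof (intro sum_mono)
    fix i j assume "i \<in> {..<N}" "j \<in> {..<N}"
    then have F: "box k s i \<subseteq> positions n k" and G: "box k s j \<subseteq> positions n k" using sub by auto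
    show "mean n k (\<lambda>A. (?X i A)^2 * (?X j A)^2) \<le> (if j = i then c else 0) + d"
    proof (cases "j = i")
      case True
      then show ?thesis
        using mean_ones_in_fourth_le[OF F n] cd unfolding card_box c_def \<mu>_def by simp
    next
      case False
      then show ?thesis
        using mean_ones_in_disjoint_le[OF F G n] box_disjoint_coord[of i j] unfolding card_box d_def \<mu>_def
        by simp
    qed
  qed
  also have "\<dots> = real N * c + (real N)^2 * d"
    by (simp add: sum.distrib sum.delta power2_eq_square algebra_simps)
  finally show ?thesis unfolding c_def d_def .
qed

subsection \<open>Long monotone subsequences\<close>

text \<open>The positions are inserted one at a time; the first coordinate of each is new, so the
  successive factors are \<open>1 / n\<close>, \<open>1 / (n - 1)\<close>, and so on down to
  \<open>1 / (n - m + 1)\<close>.\<close>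

lemma hit_prob_inj_seq_le:
  assumes "m \<le> n" "\<And>i. i \<in> {1..m} \<Longrightarrow> p i \<in> positions n k" "inj_on (\<lambda>i. p i 1) {1..m}"
  shows "hit_prob n k (p ` {1..m}) \<le> fact (n - m) / fact n"
  using assms
proof (induction m)
  case 0
  then show ?case by (simp add: hit_prob_empty)
next
  case (Suc m)
  have IH: "hit_prob n k (p ` {1..m}) \<le> fact (n - m) / fact n"
    using Suc.prems by (intro Suc.IH) (auto intro: inj_on_subset)
  have sub: "p ` {1..m} \<subseteq> positions n k" using Suc.prems(2) by auto
  have fresh: "p (Suc m) 1 \<notin> (\<lambda>\<rho>. \<rho> 1) ` (p ` {1..m})"
    using Suc.prems(3) by (force simp: inj_on_def)
  have "card (p ` {1..m}) \<le> m" using card_image_le[of "{1..m}" p] by simp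
  then have "hit_prob n k (insert (p (Suc m)) (p ` {1..m})) \<le>
      hit_prob n k (p ` {1..m}) / (real n - real m)"
    using Suc.prems(1) Suc.prems(2)[of "Suc m"] fresh
    by (intro hit_prob_insert_fresh[where i = 1, OF sub]) auto
  also have "\<dots> \<le> fact (n - m) / fact n / (real n - real m)"
    using IH Suc.prems(1) by (intro divide_right_mono) auto
  also have "(fact (n - m) :: real) = (real n - real m) * fact (n - Suc m)"
    using Suc.prems(1) fact_reduce[of "n - m", where 'a = real] by (simp add: of_nat_diff)
  also have "insert (p (Suc m)) (p ` {1..m}) = p ` {1..Suc m}"
    by (simp add: atLeastAtMostSuc_conv)
  finally show ?case using Suc.prems(1) by simp
qed

section \<open>Counting monotone sequences and the union bound\<close>

definition monotone_maps :: "nat \<Rightarrow> nat \<Rightarrow> (nat \<Rightarrow> nat) set" where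
  "monotone_maps n m = {f \<in> {1..m} \<rightarrow>\<^sub>E {1..n}.
     strict_mono_on {1..m} f \<or> strict_antimono_on {1..m} f}"

lemma finite_monotone_maps: "finite (monotone_maps n m)"
  unfolding monotone_maps_def
  by (rule finite_subset[OF _ finite_PiE[of "{1..m}" "\<lambda>_. {1..n}"]]) auto

lemma monotone_maps_inj_on:
  assumes "f \<in> monotone_maps n m"
  shows "inj_on f {1..m}"
proof (rule linorder_inj_onI)
  fix i j assume "i \<in> {1..m}" "j \<in> {1..m}" "i < j"
  then show "f i \<noteq> f j"
    using assms unfolding monotone_maps_def monotone_on_def by (metis (no_types, lifting) less_irrefl mem_Collect_eq)
qed auto

text \<open>The direction and the image determine the map: its values are the elements of an
  \<open>m\<close>-subset of [n] in sorted or in reversed order.\<close>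

lemma card_monotone_maps: "card (monotone_maps n m) \<le> 2 * (n choose m)"
proof -
  let ?E = "{1..m} \<rightarrow>\<^sub>E {1..n}"
  let ?S = "{K. K \<subseteq> {1..n} \<and> card K = m}"
  define up where "up = {f \<in> ?E. strict_mono_on {1..m} f}"
  define down where "down = {f \<in> ?E. strict_antimono_on {1..m} f}"
  have eqI: "f = g" if "f \<in> ?E" "g \<in> ?E" "map f [1..<Suc m] = map g [1..<Suc m]" for f g
    using that by (intro PiE_ext[of f "{1..m}" "\<lambda>_. {1..n}" g]) (auto simp del: upt_Suc)
  have set_eq: "set (map f [1..<Suc m]) = f ` {1..m}" for f :: "nat \<Rightarrow> nat"
    by (simp del: upt_Suc add: atLeastLessThanSuc_atLeastAtMost)
  have cS: "card ?S = n choose m" using n_subsets[of "{1..n}" m] by simp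
  have fS: "finite ?S" by (rule finite_subset[of _ "Pow {1..n}"]) auto
  have mem: "f ` {1..m} \<in> ?S" if "f \<in> ?E" "inj_on f {1..m}" for f
    using that by (auto simp: card_image)
  have "sorted_wrt (<) (map f [1..<Suc m])" if "f \<in> up" for f
    unfolding sorted_wrt_iff_nth_less using that
    by (auto simp: up_def monotone_on_def simp del: upt_Suc)
  then have up_sorted: "sorted (map f [1..<Suc m])" "distinct (map f [1..<Suc m])" if "f \<in> up" for f
    using that by (simp_all add: strict_sorted_iff del: upt_Suc)
  have "sorted_wrt (>) (map f [1..<Suc m])" if "f \<in> down" for f
    unfolding sorted_wrt_iff_nth_less using that
    by (auto simp: down_def monotone_on_def simp del: upt_Suc)
  then have down_sorted: "sorted (rev (map f [1..<Suc m]))" "distinct (rev (map f [1..<Suc m]))"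
    if "f \<in> down" for f
    using that strict_sorted_iff[of "rev (map f [1..<Suc m])"] by (simp_all add: sorted_wrt_rev del: upt_Suc)
  have "card up \<le> card ?S"
  proof (rule card_inj_on_le[OF _ _ fS])
    show "inj_on (\<lambda>f. f ` {1..m}) up"
    proof (rule inj_onI)
      fix f g assume fg: "f \<in> up" "g \<in> up" "f ` {1..m} = g ` {1..m}"
      have "map f [1..<Suc m] = map g [1..<Suc m]"
        by (rule sorted_distinct_set_unique) (use up_sorted fg set_eq in auto)
      then show "f = g" using fg eqI unfolding up_def by blast
    qed
    show "(\<lambda>f. f ` {1..m}) ` up \<subseteq> ?S"
      using mem by (auto simp: up_def strict_mono_on_imp_inj_on)
  qed
  moreover have "card down \<le> card ?S"
  proof (rule card_inj_on_le[OF _ _ fS])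
    show "inj_on (\<lambda>f. f ` {1..m}) down"
    proof (rule inj_onI)
      fix f g assume fg: "f \<in> down" "g \<in> down" "f ` {1..m} = g ` {1..m}"
      have "rev (map f [1..<Suc m]) = rev (map g [1..<Suc m])"
        by (rule sorted_distinct_set_unique) (use down_sorted fg set_eq in \<open>auto simp del: upt_Suc\<close>)
      then show "f = g" using fg eqI unfolding down_def by (metis (no_types, lifting) mem_Collect_eq rev_rev_ident)
    qed
    have "down \<subseteq> monotone_maps n m" unfolding down_def monotone_maps_def by blast
    then show "(\<lambda>f. f ` {1..m}) ` down \<subseteq> ?S"
      using mem monotone_maps_inj_on by (auto simp: down_def)
  qed
  moreover have "monotone_maps n m = up \<union> down"
    unfolding monotone_maps_def up_def down_def by blast
  ultimately show ?thesis using card_Un_le[of up down] cS by simp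
qed

lemma monotone_subseq_of_longest:
  assumes "m \<le> longest_monotone n k A"
  shows "\<exists>s. monotone_subseq n k A m s"
proof -
  obtain s where s: "monotone_subseq n k A (longest_monotone n k A) s"
    using Max_in[OF finite_monotone_subseq_lengths monotone_subseq_lengths_nonempty]
    unfolding longest_monotone_def by blast
  have sub: "{1..m} \<subseteq> {1..longest_monotone n k A}" using assms by simp
  show ?thesis
    using s sub unfolding monotone_subseq_def by (meson monotone_on_subset subsetD)
qed

lemma longest_monotone_le: "longest_monotone n k A \<le> n"
  using monotone_subseq_of_longest[OF le_refl] monotone_subseq_length_le by blast

lemma prob_longest_ge_le_binomial:
  assumes m: "m \<le> n"
  shows "mean n k (\<lambda>A. of_bool (m \<le> longest_monotone n k A))
    \<le> real (2 * (n choose m)) ^ (k + 1) * (fact (n - m) / fact n)"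
proof -
  \<comment> \<open>A monotone sequence is encoded by one monotone map per coordinate, each with its
    own direction; \<open>p\<close> turns such a family into the sequence of its positions.\<close>
  define C where "C = ({1..k+1} \<rightarrow>\<^sub>E monotone_maps n m)"
  define p where "p = (\<lambda>c :: nat \<Rightarrow> nat \<Rightarrow> nat. \<lambda>i. \<lambda>j\<in>{1..k+1}. c j i)"
  have fC: "finite C" unfolding C_def by (intro finite_PiE finite_monotone_maps) simp
  have "mean n k (\<lambda>A. of_bool (m \<le> longest_monotone n k A))
     \<le> mean n k (\<lambda>A. \<Sum>c\<in>C. of_bool (p c ` {1..m} \<subseteq> ones n k A))"
  proof (rule mean_mono)
    fix A
    show "of_bool (m \<le> longest_monotone n k A) \<le> (\<Sum>c\<in>C. of_bool (p c ` {1..m} \<subseteq> ones n k A) :: real)"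
    proof (cases "m \<le> longest_monotone n k A")
      case True
      then obtain s where s: "monotone_subseq n k A m s" using monotone_subseq_of_longest by blast
      have sG: "s i \<in> ones n k A" if "i \<in> {1..m}" for i using s that unfolding monotone_subseq_def by blast
      then have spos: "s i \<in> positions n k" if "i \<in> {1..m}" for i using that unfolding ones_def by blast
      define c where "c = (\<lambda>j\<in>{1..k+1}. \<lambda>i\<in>{1..m}. s i j)"
      have "(\<lambda>i\<in>{1..m}. s i j) \<in> monotone_maps n m" if j: "j \<in> {1..k+1}" for j
      proof -
        have "strict_mono_on {1..m} (\<lambda>i. s i j) \<or> strict_antimono_on {1..m} (\<lambda>i. s i j)"
          using s j unfolding monotone_subseq_def by blast
        then have "strict_mono_on {1..m} (\<lambda>i\<in>{1..m}. s i j) \<or> strict_antimono_on {1..m} (\<lambda>i\<in>{1..m}. s i j)"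
          by (simp add: monotone_on_def)
        then show ?thesis unfolding monotone_maps_def using positions_in[OF spos j] by auto
      qed
      then have cC: "c \<in> C" unfolding C_def c_def by auto
      have "p c i = s i" if "i \<in> {1..m}" for i
        using that spos[OF that] unfolding p_def c_def positions_def
        by (auto simp: fun_eq_iff PiE_iff extensional_def)
      then have "p c ` {1..m} \<subseteq> ones n k A" using sG by auto
      then have "1 \<le> (\<Sum>c\<in>{c}. of_bool (p c ` {1..m} \<subseteq> ones n k A) :: real)" by simp
      also have "\<dots> \<le> (\<Sum>c\<in>C. of_bool (p c ` {1..m} \<subseteq> ones n k A))"
        using fC cC by (intro sum_mono2) auto
      finally show ?thesis using True by simp
    qed (simp add: sum_nonneg)
  qed
  also have "\<dots> = (\<Sum>c\<in>C. hit_prob n k (p c ` {1..m}))"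
    unfolding mean_sum hit_prob_def ..
  also have "\<dots> \<le> (\<Sum>c\<in>C. fact (n - m) / fact n)"
  proof (intro sum_mono hit_prob_inj_seq_le m)
    fix c assume c: "c \<in> C"
    have cj: "c j \<in> monotone_maps n m" if "j \<in> {1..k+1}" for j
      using c that unfolding C_def by (rule PiE_mem)
    show "p c i \<in> positions n k" if "i \<in> {1..m}" for i
      using cj that unfolding p_def positions_def monotone_maps_def by fastforce
    have "inj_on (c 1) {1..m}" using cj by (intro monotone_maps_inj_on[of _ n]) simp
    then show "inj_on (\<lambda>i. p c i 1) {1..m}" unfolding p_def by simp
  qed
  also have "\<dots> = real (card C) * (fact (n - m) / fact n)" by simp
  also have "\<dots> \<le> real (2 * (n choose m)) ^ (k + 1) * (fact (n - m) / fact n)"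
  proof (intro mult_right_mono)
    have "card C = card (monotone_maps n m) ^ (k + 1)" unfolding C_def by (simp add: card_PiE)
    also have "\<dots> \<le> (2 * (n choose m)) ^ (k + 1)" by (intro power_mono card_monotone_maps) simp
    finally show "real (card C) \<le> real (2 * (n choose m)) ^ (k + 1)"
      by (metis of_nat_le_iff of_nat_power)
  qed simp
  finally show ?thesis .
qed

text \<open>\<open>m ^ m / fact m\<close> is a single term of the exponential series at
  \<open>m\<close>.\<close>

lemma power_self_le_exp_fact: "real m ^ m \<le> exp (real m) * fact m"
proof -
  have "(\<Sum>i\<in>{m}. real m ^ i /\<^sub>R fact i) \<le> exp (real m)"
    using sum_le_suminf[OF sums_summable[OF exp_converges[of "real m"]], of "{m}"]
      sums_unique[OF exp_converges[of "real m"]] by simp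
  then show ?thesis by (simp add: field_simps)
qed

text \<open>One of the \<open>k + 1\<close> binomials cancels against
  \<open>fact (n - m) / fact n\<close> and leaves \<open>1 / fact m\<close>; the others are at most
  \<open>n ^ m / fact m\<close>. Bounding the factorials turns the product into an
  \<open>m\<close>-th power whose base is below 1 exactly when m > e n^(k/(k+1)).\<close>

lemma prob_longest_ge_le:
  assumes m: "m > 0"
  shows "mean n k (\<lambda>A. of_bool (m \<le> longest_monotone n k A))
    \<le> 2 ^ (k + 1) * (real n ^ k * exp 1 ^ (k + 1) / real m ^ (k + 1)) ^ m"
proof (cases "m \<le> n")
  case True
  have "mean n k (\<lambda>A. of_bool (m \<le> longest_monotone n k A))
    \<le> real (2 * (n choose m)) ^ (k + 1) * (fact (n - m) / fact n)"
    by (rule prob_longest_ge_le_binomial[OF True])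
  also have "\<dots> = 2 ^ (k + 1) * real (n choose m) ^ k * (real (n choose m) * fact (n - m) / fact n)"
    by (simp add: power_mult_distrib)
  also have "real (n choose m) * fact (n - m) / fact n = 1 / fact m"
    using binomial_fact[OF True, where 'a = real] by simp
  also have "2 ^ (k + 1) * real (n choose m) ^ k * (1 / fact m) \<le>
     2 ^ (k + 1) * (real n ^ m / fact m) ^ k * (1 / fact m)"
  proof (intro mult_right_mono mult_left_mono power_mono)
    have "real ((n choose m) * fact m) \<le> real (n ^ m)" using binomial_fact_pow of_nat_le_iff by blast
    then show "real (n choose m) \<le> real n ^ m / fact m" by (simp add: field_simps)
  qed auto
  also have "\<dots> = 2 ^ (k + 1) * (real n ^ (m * k) * (1 / fact m) ^ (k + 1))"
    by (simp add: power_mult power_divide power_one_over)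
  also have "\<dots> \<le> 2 ^ (k + 1) * (real n ^ (m * k) * (exp (real m) / real m ^ m) ^ (k + 1))"
  proof (intro mult_left_mono power_mono)
    show "1 / fact m \<le> exp (real m) / real m ^ m"
      using power_self_le_exp_fact[of m] m by (simp add: field_simps)
  qed auto
  also have "exp (real m) = exp 1 ^ m" using exp_of_nat_mult[of m "1::real"] by simp
  also have "real n ^ (m * k) * (exp 1 ^ m / real m ^ m) ^ (k + 1) =
     (real n ^ k * exp 1 ^ (k + 1) / real m ^ (k + 1)) ^ m"
  proof -
    have "(exp 1 ^ m / real m ^ m) ^ (k + 1) = ((exp 1 / real m) ^ (k + 1)) ^ m"
      by (simp only: power_divide[symmetric] power_mult[symmetric] mult.commute)
    moreover have "real n ^ (m * k) = (real n ^ k) ^ m"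
      by (simp only: power_mult[symmetric] mult.commute)
    ultimately show ?thesis by (simp only: power_mult_distrib[symmetric] power_divide times_divide_eq_right)
  qed
  finally show ?thesis .
next
  case False
  then have "\<not> m \<le> longest_monotone n k A" for A using longest_monotone_le[of n k A] by linarith
  then have "mean n k (\<lambda>A. of_bool (m \<le> longest_monotone n k A)) = 0"
    by (simp add: mean_const)
  then show ?thesis by simp
qed

text \<open>At the threshold \<open>c\<close> the base of the \<open>m\<close>-th power is at most
  \<open>exp 1 / c < 1\<close>. Since \<open>k \<ge> 1\<close> gives k/(k+1) >= 1/2, the exponent
  \<open>m\<close> is at least sqrt n, a form of decay that no longer involves \<open>k\<close> in
  the exponent.\<close>

lemma prob_normalized_gt_le:
  assumes k: "k \<ge> 1" and n: "n \<ge> 1" and c: "c > exp 1"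
  shows "mean n k (\<lambda>A. of_bool (normalized_H n k A > c))
    \<le> 2 ^ (k + 1) * (exp 1 / c) powr (real n powr (1 / 2))"
proof -
  define e where "e = real k / real (k + 1)"
  define m where "m = nat \<lceil>c * real n powr e\<rceil>"
  have c0: "0 < c" "1 \<le> c" using c by (auto intro: less_trans[OF exp_gt_zero] order.trans[OF _ less_imp_le[OF c]])
  have mge: "c * real n powr e \<le> real m" unfolding m_def by linarith
  have pos: "0 < c * real n powr e" using c0 n by simp
  have m0: "m > 0" using mge pos by (metis gr0I less_le_not_le of_nat_0)
  have "mean n k (\<lambda>A. of_bool (normalized_H n k A > c)) \<le> mean n k (\<lambda>A. of_bool (m \<le> longest_monotone n k A))"
  proof (rule mean_mono)
    fix A
    have "m \<le> longest_monotone n k A" if "normalized_H n k A > c"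
    proof -
      have "c < real (longest_monotone n k A) / real n powr e"
        using that unfolding normalized_H_def e_def powr_minus by (simp add: divide_inverse)
      then have "c * real n powr e \<le> real (longest_monotone n k A)"
        using n by (simp add: field_simps)
      then show ?thesis unfolding m_def by (simp add: nat_le_iff ceiling_le_iff)
    qed
    then show "(of_bool (normalized_H n k A > c) :: real) \<le> of_bool (m \<le> longest_monotone n k A)" by auto
  qed
  also have "\<dots> \<le> 2 ^ (k + 1) * (real n ^ k * exp 1 ^ (k + 1) / real m ^ (k + 1)) ^ m"
    by (rule prob_longest_ge_le[OF m0])
  also have "\<dots> \<le> 2 ^ (k + 1) * ((exp 1 / c) ^ (k + 1)) ^ m"
  proof (intro mult_left_mono power_mono)
    have "(real n powr e) ^ (k + 1) = real n ^ k"
    proof -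
      have "(real n powr e) ^ (k + 1) = real n powr (e * real (k + 1))"
        using n by (simp only: powr_realpow[symmetric] powr_powr powr_gt_zero)
      also have "\<dots> = real n ^ k" using n by (simp add: e_def powr_realpow)
      finally show ?thesis .
    qed
    then have "c ^ (k + 1) * real n ^ k = (c * real n powr e) ^ (k + 1)" by (simp only: power_mult_distrib)
    also have "\<dots> \<le> real m ^ (k + 1)" using mge pos by (intro power_mono) auto
    finally have "c ^ (k + 1) * real n ^ k \<le> real m ^ (k + 1)" .
    then have "real n ^ k * exp 1 ^ (k + 1) / real m ^ (k + 1) \<le>
        real n ^ k * exp 1 ^ (k + 1) / (c ^ (k + 1) * real n ^ k)"
      using c0 n m0 by (intro divide_left_mono) auto
    also have "\<dots> = (exp 1 / c) ^ (k + 1)" using n by (simp add: power_divide field_simps)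
    finally show "real n ^ k * exp 1 ^ (k + 1) / real m ^ (k + 1) \<le> (exp 1 / c) ^ (k + 1)" .
  qed auto
  also have "\<dots> \<le> 2 ^ (k + 1) * (exp 1 / c) ^ m"
  proof (intro mult_left_mono power_mono)
    show "(exp 1 / c) ^ (k + 1) \<le> exp 1 / c"
      using c c0 power_decreasing[of 1 "k + 1" "exp 1 / c"] by simp
  qed (use c0 in auto)
  also have "(exp 1 / c) ^ m = (exp 1 / c) powr real m" using c0 by (simp add: powr_realpow)
  also have "2 ^ (k + 1) * (exp 1 / c) powr real m \<le> 2 ^ (k + 1) * (exp 1 / c) powr (real n powr (1 / 2))"
  proof (intro mult_left_mono)
    have "1 / 2 \<le> e" unfolding e_def using k by (simp add: field_simps)
    then have "real n powr (1 / 2) \<le> real n powr e" using n by (intro powr_mono) auto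
    also have "\<dots> \<le> c * real n powr e" using c0 by (simp add: mult_le_cancel_right1)
    finally have "real n powr (1 / 2) \<le> real m" using mge by linarith
    then show "(exp 1 / c) powr real m \<le> (exp 1 / c) powr (real n powr (1 / 2))"
      using c c0 by (intro powr_mono') auto
  qed simp
  finally show ?thesis .
qed

subsection \<open>Asymptotics\<close>

text \<open>The version with the factor \<open>n\<close> is for the expectation: on the exceptional
  event \<open>normalized_H\<close> is bounded only by \<open>n\<close>, so its probability must be
  o(1/n).\<close>

lemma prob_normalized_gt_tendsto:
  assumes k: "k \<ge> 1" and c: "c > exp 1"
  shows "(\<lambda>n. real n * mean n k (\<lambda>A. of_bool (normalized_H n k A > c))) \<longlonglongrightarrow> 0"
    "(\<lambda>n. mean n k (\<lambda>A. of_bool (normalized_H n k A > c))) \<longlonglongrightarrow> 0"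
proof -
  define d where "d = - ln (exp 1 / c)"
  have c0: "0 < c" using c by (rule less_trans[OF exp_gt_zero])
  then have "ln (exp 1 / c) < 0" using c by (intro ln_less_zero) auto
  then have d: "0 < d" unfolding d_def by simp
  have bound: "mean n k (\<lambda>A. of_bool (normalized_H n k A > c)) \<le> 2 ^ (k + 1) * exp (- d * real n powr (1 / 2))"
    if "n \<ge> 1" for n
    using prob_normalized_gt_le[OF k that c] c0 unfolding d_def
    by (simp add: powr_def[of "exp 1 / c"] mult.commute)
  have nonneg: "0 \<le> mean n k (\<lambda>A. of_bool (normalized_H n k A > c))" for n
    by (rule mean_nonneg) simp
  have lim: "(\<lambda>n. 2 ^ (k + 1) * exp (- d * real n powr (1 / 2))) \<longlonglongrightarrow> 0"
    using d by real_asymp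
  show "(\<lambda>n. mean n k (\<lambda>A. of_bool (normalized_H n k A > c))) \<longlonglongrightarrow> 0"
    by (rule tendsto_sandwich[OF _ _ tendsto_const lim])
      (use nonneg in simp, rule eventually_mono[OF eventually_ge_at_top[of 1] bound])
  have lim: "(\<lambda>n. real n * (2 ^ (k + 1) * exp (- d * real n powr (1 / 2)))) \<longlonglongrightarrow> 0"
    using d by real_asymp
  show "(\<lambda>n. real n * mean n k (\<lambda>A. of_bool (normalized_H n k A > c))) \<longlonglongrightarrow> 0"
  proof (rule tendsto_sandwich[OF _ _ tendsto_const lim])
    show "\<forall>\<^sub>F n in sequentially. real n * mean n k (\<lambda>A. of_bool (normalized_H n k A > c))
        \<le> real n * (2 ^ (k + 1) * exp (- d * real n powr (1 / 2)))"
      using eventually_ge_at_top[of 1] by eventually_elim (intro mult_left_mono bound, auto)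
  qed (simp add: nonneg)
qed

lemma normalized_H_le: "normalized_H n k A \<le> real n"
proof (cases "n = 0")
  case True
  then show ?thesis using longest_monotone_le[of n k A] by (simp add: normalized_H_def)
next
  case False
  have "real n powr (- (real k / real (k + 1))) \<le> real n powr 0" using False by (intro powr_mono) auto
  then have "normalized_H n k A \<le> real n * 1"
    unfolding normalized_H_def using longest_monotone_le[of n k A] False
    by (intro mult_mono) auto
  then show ?thesis by simp
qed

lemma mean_normalized_H_eventually_le:
  assumes k: "k \<ge> 1" and e: "e > 0"
  shows "\<forall>\<^sub>F n in sequentially. mean n k (normalized_H n k) \<le> exp 1 + e"
proof -
  define c where "c = exp 1 + e / 2"
  have c: "c > exp 1" unfolding c_def using e by simp
  have c0: "0 < c" using c by (rule less_trans[OF exp_gt_zero])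
  have le: "mean n k (normalized_H n k) \<le> c + real n * mean n k (\<lambda>A. of_bool (normalized_H n k A > c))" for n
  proof -
    have "mean n k (normalized_H n k) \<le> mean n k (\<lambda>A. c + real n * of_bool (normalized_H n k A > c))"
      by (rule mean_mono) (use normalized_H_le c0 in \<open>auto intro: add_increasing\<close>)
    then show ?thesis by (simp add: mean_add mean_const mean_cmult)
  qed
  have "\<forall>\<^sub>F n in sequentially. real n * mean n k (\<lambda>A. of_bool (normalized_H n k A > c)) < e / 2"
    using order_tendstoD(2)[OF prob_normalized_gt_tendsto(1)[OF k c], of "e / 2"] e by simp
  then show ?thesis
  proof eventually_elim
    case (elim n)
    then show ?case using le[of n] unfolding c_def by linarith
  qed
qed

section \<open>Sizes and numbers of the boxes, and their limits\<close>

definition side :: "nat \<Rightarrow> real \<Rightarrow> nat \<Rightarrow> nat" where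
  "side k C n = nat \<lceil>(C * real n) powr (1 / real (k + 1))\<rceil>"

definition num_boxes :: "nat \<Rightarrow> real \<Rightarrow> nat \<Rightarrow> nat" where
  "num_boxes k C n = n div side k C n"

lemma num_boxes_side_le: "num_boxes k C n * side k C n \<le> n"
  unfolding num_boxes_def by simp

lemma side_tendsto:
  assumes C: "C > 0"
  shows "(\<lambda>n. real (side k C n) / real n powr (1 / real (k + 1))) \<longlonglongrightarrow> C powr (1 / real (k + 1))"
proof -
  define a where "a = 1 / real (k + 1)"
  have a: "a > 0" unfolding a_def by simp
  have bounds: "(C * real n) powr a \<le> real (side k C n)" "real (side k C n) \<le> (C * real n) powr a + 1" for n
    using powr_ge_zero[of "C * real n" a] unfolding side_def a_def[symmetric] by linarith+
  have split: "(C * real n) powr a / real n powr a = C powr a" if "n \<ge> 1" for n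
    using C that by (simp add: powr_mult)
  show ?thesis unfolding a_def[symmetric]
  proof (rule tendsto_sandwich)
    show "\<forall>\<^sub>F n in sequentially. C powr a \<le> real (side k C n) / real n powr a"
      using eventually_ge_at_top[of 1]
      by eventually_elim (metis split bounds(1) divide_right_mono powr_ge_zero)
    show "\<forall>\<^sub>F n in sequentially. real (side k C n) / real n powr a \<le> C powr a + 1 / real n powr a"
      using eventually_ge_at_top[of 1]
      by eventually_elim (metis split bounds(2) divide_right_mono powr_ge_zero add_divide_distrib)
    show "(\<lambda>n. C powr a) \<longlonglongrightarrow> C powr a" by simp
    have "(\<lambda>n. 1 / real n powr a) \<longlonglongrightarrow> 0" using a by real_asymp
    then show "(\<lambda>n. C powr a + 1 / real n powr a) \<longlonglongrightarrow> C powr a"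
      using tendsto_add[OF tendsto_const, of _ 0 sequentially "C powr a"] by fastforce
  qed
qed

text \<open>Since a position is a one with probability \<open>1 / n\<close>, this says that a box of
  this side holds \<open>C\<close> ones on average in the limit; the rounding in \<open>side\<close>
  disappears.\<close>

lemma box_volume_tendsto:
  assumes C: "C > 0"
  shows "(\<lambda>n. real (side k C n ^ (k + 1)) / real n) \<longlonglongrightarrow> C"
proof -
  have pow: "(x powr (1 / real (k + 1))) ^ (k + 1) = x" if "x > 0" for x :: real
  proof -
    have "(x powr (1 / real (k + 1))) ^ (k + 1) = x powr (1 / real (k + 1) * real (k + 1))"
      using that by (simp only: powr_realpow[symmetric] powr_powr powr_gt_zero)
    then show ?thesis using that by simp
  qed
  have "(\<lambda>n. (real (side k C n) / real n powr (1 / real (k + 1))) ^ (k + 1))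
      \<longlonglongrightarrow> (C powr (1 / real (k + 1))) ^ (k + 1)"
    by (intro tendsto_power side_tendsto C)
  then have lim: "(\<lambda>n. (real (side k C n) / real n powr (1 / real (k + 1))) ^ (k + 1)) \<longlonglongrightarrow> C"
    unfolding pow[OF C] .
  show ?thesis
  proof (rule Lim_transform_eventually[OF lim])
    show "\<forall>\<^sub>F n in sequentially. (real (side k C n) / real n powr (1 / real (k + 1))) ^ (k + 1) =
        real (side k C n ^ (k + 1)) / real n"
      using eventually_gt_at_top[of 0]
    proof eventually_elim
      case (elim n)
      then show ?case by (simp only: power_divide pow of_nat_power of_nat_0_less_iff)
    qed
  qed
qed

lemma side_over_n_tendsto:
  assumes k: "k \<ge> 1" and C: "C > 0"
  shows "(\<lambda>n. real (side k C n) / real n) \<longlonglongrightarrow> 0"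
proof -
  define a where "a = 1 / real (k + 1)"
  have a: "a < 1" unfolding a_def using k by simp
  have "(\<lambda>n. real n powr (a - 1)) \<longlonglongrightarrow> 0" using a by real_asymp
  from tendsto_mult[OF side_tendsto[OF C, of k] this]
  have lim: "(\<lambda>n. real (side k C n) / real n powr a * real n powr (a - 1)) \<longlonglongrightarrow> 0"
    unfolding a_def by simp
  show ?thesis
    by (rule Lim_transform_eventually[OF lim])
      (use eventually_gt_at_top[of 0] in \<open>eventually_elim, simp add: powr_diff\<close>)
qed

text \<open>Integer division loses less than one box, which the factor \<open>n powr (- e)\<close>
  sends to 0; what remains is the reciprocal of the limit of the scaled side.\<close>

lemma num_boxes_tendsto:
  assumes k: "k \<ge> 1" and C: "C > 0"
  shows "(\<lambda>n. real (num_boxes k C n) * real n powr (- (real k / real (k + 1))))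
    \<longlonglongrightarrow> C powr (- (1 / real (k + 1)))"
proof -
  define a where "a = 1 / real (k + 1)"
  define e where "e = real k / real (k + 1)"
  have ae: "1 - e = a" "e > 0" unfolding a_def e_def using k by (simp_all add: field_simps)
  define r where "r = (\<lambda>n. real (side k C n) / real n powr a)"
  have r: "r \<longlonglongrightarrow> C powr a" unfolding r_def a_def by (rule side_tendsto[OF C])
  have inv: "(\<lambda>n. inverse (r n)) \<longlonglongrightarrow> C powr (- a)"
    using tendsto_inverse[OF r] C by (simp add: powr_minus)
  have side_pos: "side k C n > 0" if "n > 0" for n
    using C that unfolding side_def by simp
  have quot: "real n / real (side k C n) * real n powr (- e) = inverse (r n)" if "n > 0" for n
  proof -
    have "real n * real n powr (- e) = real n powr a"
      using that by (simp add: powr_mult_base ae(1))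
    then show ?thesis unfolding r_def by (simp add: divide_simps)
  qed
  have "(\<lambda>n. real (num_boxes k C n) * real n powr (- e)) \<longlonglongrightarrow> C powr (- a)"
  proof (rule tendsto_sandwich)
    show "\<forall>\<^sub>F n in sequentially. inverse (r n) - real n powr (- e) \<le> real (num_boxes k C n) * real n powr (- e)"
      using eventually_gt_at_top[of 0]
    proof eventually_elim
      case (elim n)
      have "real n / real (side k C n) - 1 \<le> real (num_boxes k C n)"
      proof -
        have "n \<le> (num_boxes k C n + 1) * side k C n"
          unfolding num_boxes_def using dividend_less_div_times[OF side_pos[OF elim], of n] by simp
        then have "real n \<le> (real (num_boxes k C n) + 1) * real (side k C n)"
          by (metis of_nat_1 of_nat_add of_nat_le_iff of_nat_mult)
        then show ?thesis using side_pos[OF elim] by (simp add: field_simps)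
      qed
      then have "(real n / real (side k C n) - 1) * real n powr (- e) \<le> real (num_boxes k C n) * real n powr (- e)"
        by (intro mult_right_mono) auto
      then show ?case using quot[OF elim] by (simp add: left_diff_distrib)
    qed
    show "\<forall>\<^sub>F n in sequentially. real (num_boxes k C n) * real n powr (- e) \<le> inverse (r n)"
      using eventually_gt_at_top[of 0]
    proof eventually_elim
      case (elim n)
      have "real (num_boxes k C n) * real n powr (- e) \<le> real n / real (side k C n) * real n powr (- e)"
        unfolding num_boxes_def by (intro mult_right_mono of_nat_div_le_of_nat) auto
      then show ?case using quot[OF elim] by simp
    qed
    have "(\<lambda>n. real n powr (- e)) \<longlonglongrightarrow> 0" using ae by real_asymp
    from tendsto_diff[OF inv this] show "(\<lambda>n. inverse (r n) - real n powr (- e)) \<longlonglongrightarrow> C powr (- a)" by simp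
    show "(\<lambda>n. inverse (r n)) \<longlonglongrightarrow> C powr (- a)" by (rule inv)
  qed
  then show ?thesis unfolding a_def e_def .
qed

lemma num_boxes_eventually_pos:
  assumes "k \<ge> 1" "C > 0"
  shows "\<forall>\<^sub>F n in sequentially. num_boxes k C n > 0"
proof -
  have "\<forall>\<^sub>F n in sequentially. 0 < real (num_boxes k C n) * real n powr (- (real k / real (k + 1)))"
    using order_tendstoD(1)[OF num_boxes_tendsto[OF assms], of 0] assms by simp
  then show ?thesis by eventually_elim (auto intro: gr0I)
qed

lemma inverse_num_boxes_tendsto:
  assumes k: "k \<ge> 1" and C: "C > 0"
  shows "(\<lambda>n. 1 / real (num_boxes k C n)) \<longlonglongrightarrow> 0"
proof -
  define e where "e = real k / real (k + 1)"
  have e: "e > 0" unfolding e_def using k by simp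
  have "(\<lambda>n. real n powr (- e)) \<longlonglongrightarrow> 0" using e by real_asymp
  from tendsto_divide[OF this num_boxes_tendsto[OF k C]]
  have lim: "(\<lambda>n. real n powr (- e) / (real (num_boxes k C n) * real n powr (- e))) \<longlonglongrightarrow> 0"
    unfolding e_def using C by simp
  show ?thesis
    by (rule Lim_transform_eventually[OF lim])
      (use eventually_gt_at_top[of 0] in \<open>eventually_elim, simp\<close>)
qed

text \<open>Handles the denominators \<open>n - 1\<close>, \<open>n - 2\<close>,
  \<open>n - 3\<close> that arise when positions are inserted next to others.\<close>

lemma ratio_tendsto:
  assumes "(\<lambda>n. f n / real n) \<longlonglongrightarrow> C"
  shows "(\<lambda>n. f n / (real n - c)) \<longlonglongrightarrow> C"
proof -
  have "(\<lambda>n. real n / (real n - c)) \<longlonglongrightarrow> 1" by real_asymp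
  from tendsto_mult[OF assms this]
  have lim: "(\<lambda>n. f n / real n * (real n / (real n - c))) \<longlonglongrightarrow> C" by simp
  show ?thesis
    by (rule Lim_transform_eventually[OF lim])
      (use eventually_gt_at_top[of 0] in \<open>eventually_elim, simp\<close>)
qed

section \<open>Lower bounds for the expectation and in probability\<close>

lemma mean_normalized_H_eventually_ge:
  assumes k: "k \<ge> 1" and e: "e > 0"
  shows "\<forall>\<^sub>F n in sequentially. 1 - (ln (real k) + 1) / (real k + 1) - e \<le> mean n k (normalized_H n k)"
proof -
  define C where "C = real k"
  have C: "C > 0" unfolding C_def using k by simp
  define a where "a = 1 / (1 + C)"
  have a0: "0 \<le> a" unfolding a_def using C by simp
  define x where "x = 1 / real (k + 1)"
  define N where "N = num_boxes k C"
  define \<mu> where "\<mu> = (\<lambda>n. real (side k C n ^ (k + 1)))"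
  define g where "g = (\<lambda>n. real (N n) * real n powr (- (real k / real (k + 1))) *
     (2 * a * (\<mu> n / real n) - a^2 * (\<mu> n / real n * (1 + \<mu> n / (real n - 1)))))"
  have \<mu>: "(\<lambda>n. \<mu> n / real n) \<longlonglongrightarrow> C" unfolding \<mu>_def by (rule box_volume_tendsto[OF C])
  have "g \<longlonglongrightarrow> C powr (- x) * (2 * a * C - a^2 * (C * (1 + C)))"
    unfolding g_def N_def x_def by (intro tendsto_intros num_boxes_tendsto[OF k C] \<mu> ratio_tendsto[OF \<mu>])
  moreover have "2 * a * C - a^2 * (C * (1 + C)) = C / (1 + C)"
  proof -
    have "a * (1 + C) = 1" unfolding a_def using C by simp
    moreover have "a^2 * (C * (1 + C)) = a * C * (a * (1 + C))" by (simp add: power2_eq_square)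
    ultimately have "a^2 * (C * (1 + C)) = a * C" by simp
    then show ?thesis unfolding a_def by simp
  qed
  ultimately have g: "g \<longlonglongrightarrow> C powr (- x) * (C / (1 + C))" by simp
  \<comment> \<open>\<open>C powr (- x) \<ge> 1 - x * ln C\<close> by the tangent of the exponential
    at 0; multiplying out with \<open>1 - x\<close> leaves the surplus
    \<open>x\<^sup>2 * ln C\<close>, nonnegative because \<open>k \<ge> 1\<close>.\<close>
  have target: "1 - (ln (real k) + 1) / (real k + 1) \<le> C powr (- x) * (C / (1 + C))"
  proof -
    have x: "C / (1 + C) = 1 - x" "0 < x" "x < 1" unfolding x_def C_def using k by (simp_all add: field_simps)
    have L: "0 \<le> ln C" unfolding C_def using k by simp
    have "1 + (- x * ln C) \<le> exp (- x * ln C)" by (rule exp_ge_add_one_self)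
    also have "exp (- x * ln C) = C powr (- x)" using C by (simp add: powr_def)
    finally have "(1 - x * ln C) * (1 - x) \<le> C powr (- x) * (1 - x)"
      using x by (intro mult_right_mono) auto
    moreover have "1 - (ln C + 1) * x \<le> (1 - x * ln C) * (1 - x)"
      using mult_nonneg_nonneg[OF mult_nonneg_nonneg[OF less_imp_le[OF x(2)] less_imp_le[OF x(2)]] L]
      by (simp add: algebra_simps)
    moreover have "(ln C + 1) * x = (ln (real k) + 1) / (real k + 1)"
      unfolding C_def x_def by (simp add: add.commute)
    ultimately show ?thesis using x(1) by simp
  qed
  have "\<forall>\<^sub>F n in sequentially. C powr (- x) * (C / (1 + C)) - e < g n"
    using order_tendstoD(1)[OF g] e by simp
  then show ?thesis using eventually_gt_at_top[of 1]
  proof eventually_elim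
    case (elim n)
    define w where "w = real n powr (- (real k / real (k + 1)))"
    have w: "0 \<le> w" unfolding w_def by simp
    have NS: "N n * side k C n \<le> n" unfolding N_def by (rule num_boxes_side_le)
    have "g n = w * (2 * a * (real (N n) * (\<mu> n / real n)) -
        a^2 * (real (N n) * (\<mu> n / real n * (1 + \<mu> n / (real n - 1)))))"
      unfolding g_def w_def by (simp add: algebra_simps)
    also have "\<dots> \<le> w * (2 * a * mean n k (total_ones n k (side k C n) (N n)) -
        a^2 * mean n k (total_squares n k (side k C n) (N n)))"
      using mean_total_ones[OF NS, of k] mean_total_squares_le[OF NS elim(2), of k]
      unfolding \<mu>_def by (intro mult_left_mono w diff_mono) (use a0 in auto)
    also have "\<dots> = w * mean n k (\<lambda>A. 2 * a * total_ones n k (side k C n) (N n) A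
        - a^2 * total_squares n k (side k C n) (N n) A)"
      by (simp add: mean_diff mean_cmult)
    also have "\<dots> \<le> w * mean n k (\<lambda>A. real (longest_monotone n k A))"
      by (intro mult_left_mono w mean_mono longest_monotone_ge_totals)
    also have "\<dots> = mean n k (normalized_H n k)"
      unfolding mean_cmult[symmetric] by (rule mean_cong) (simp add: normalized_H_def w_def)
    finally show ?case using target elim(1) by linarith
  qed
qed

text \<open>Chebyshev around the limit \<open>t\<close> in place of the mean: the mean of
  \<open>(F - t)\<^sup>2\<close> is at most \<open>b - 2 * t * a + t\<^sup>2\<close>, which tends to
  0. As \<open>t \<ge> 0\<close>, a lower bound on the mean and an upper bound on the second moment
  are all that has to be supplied.\<close>

lemma second_moment_concentration:
  fixes F :: "nat \<Rightarrow> ((nat \<Rightarrow> nat) \<Rightarrow> nat) \<Rightarrow> real"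
  assumes t: "t \<ge> 0" and \<delta>: "\<delta> > 0"
    and lower: "\<forall>\<^sub>F n in sequentially. a n \<le> mean n k (F n)" "a \<longlonglongrightarrow> t"
    and upper: "\<forall>\<^sub>F n in sequentially. mean n k (\<lambda>A. (F n A)^2) \<le> b n" "b \<longlonglongrightarrow> t^2"
  shows "(\<lambda>n. mean n k (\<lambda>A. of_bool (\<delta> \<le> \<bar>F n A - t\<bar>))) \<longlonglongrightarrow> 0"
proof (rule tendsto_sandwich[OF _ _ tendsto_const])
  have "(\<lambda>n. (b n - 2 * t * a n + t^2) / \<delta>^2) \<longlonglongrightarrow> (t^2 - 2 * t * t + t^2) / \<delta>^2"
    using \<delta> by (intro tendsto_intros lower(2) upper(2)) auto
  then show "(\<lambda>n. (b n - 2 * t * a n + t^2) / \<delta>^2) \<longlonglongrightarrow> 0" by (simp add: power2_eq_square)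
  show "\<forall>\<^sub>F n in sequentially. mean n k (\<lambda>A. of_bool (\<delta> \<le> \<bar>F n A - t\<bar>)) \<le> (b n - 2 * t * a n + t^2) / \<delta>^2"
    using lower(1) upper(1)
  proof eventually_elim
    case (elim n)
    have "\<delta>^2 * mean n k (\<lambda>A. of_bool (\<delta> \<le> \<bar>F n A - t\<bar>)) \<le> mean n k (\<lambda>A. (F n A)^2 - 2 * t * F n A + t^2)"
      unfolding mean_cmult[symmetric]
    proof (rule mean_mono)
      fix A
      have "\<delta>^2 \<le> (F n A - t)^2" if "\<delta> \<le> \<bar>F n A - t\<bar>"
        using that \<delta> by (metis abs_le_square_iff abs_of_pos)
      then show "\<delta>^2 * of_bool (\<delta> \<le> \<bar>F n A - t\<bar>) \<le> (F n A)^2 - 2 * t * F n A + t^2"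
        using zero_le_power2[of "F n A - t"] by (auto simp: power2_diff algebra_simps)
    qed
    also have "\<dots> = mean n k (\<lambda>A. (F n A)^2) - 2 * t * mean n k (F n) + t^2"
      by (simp add: mean_add mean_diff mean_cmult mean_const)
    also have "\<dots> \<le> b n - 2 * t * a n + t^2"
      using elim t by (intro add_right_mono diff_mono mult_left_mono) auto
    finally show ?case using \<delta> by (simp add: pos_le_divide_eq mult.commute)
  qed
qed (simp_all add: mean_nonneg)

lemma total_ones_concentration:
  fixes k :: nat
  defines "N \<equiv> num_boxes k 1" and "s \<equiv> side k 1"
  assumes k: "k \<ge> 1" and \<delta>: "\<delta> > 0"
  shows "(\<lambda>n. mean n k (\<lambda>A. of_bool (\<delta> \<le> \<bar>total_ones n k (s n) (N n) A / real (N n) - 1\<bar>))) \<longlonglongrightarrow> 0"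
proof -
  define \<mu> where "\<mu> = (\<lambda>n. real (s n ^ (k + 1)))"
  have \<mu>: "(\<lambda>n. \<mu> n / real n) \<longlonglongrightarrow> 1" unfolding \<mu>_def s_def by (rule box_volume_tendsto) simp
  have iN: "(\<lambda>n. 1 / real (N n)) \<longlonglongrightarrow> 0" unfolding N_def by (rule inverse_num_boxes_tendsto[OF k]) simp
  have pos: "\<forall>\<^sub>F n in sequentially. N n > 0" unfolding N_def by (rule num_boxes_eventually_pos[OF k]) simp
  have NS: "N n * s n \<le> n" for n unfolding N_def s_def by (rule num_boxes_side_le)
  show ?thesis
  proof (rule second_moment_concentration)
    show "\<forall>\<^sub>F n in sequentially. \<mu> n / real n \<le> mean n k (\<lambda>A. total_ones n k (s n) (N n) A / real (N n))"
      using pos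
    proof eventually_elim
      case (elim n)
      have "mean n k (\<lambda>A. total_ones n k (s n) (N n) A / real (N n)) = \<mu> n / real n"
        using mean_cmult[of n k "1 / real (N n)" "total_ones n k (s n) (N n)"] elim
          mean_total_ones[OF NS[of n], of k] unfolding \<mu>_def by simp
      then show ?case by simp
    qed
    show "(\<lambda>n. \<mu> n / real n) \<longlonglongrightarrow> 1" by (rule \<mu>)
    show "\<forall>\<^sub>F n in sequentially. mean n k (\<lambda>A. (total_ones n k (s n) (N n) A / real (N n))^2)
        \<le> \<mu> n / real n * (1 / real (N n) + \<mu> n / (real n - 1))"
      using pos eventually_gt_at_top[of 1]
    proof eventually_elim
      case (elim n)
      have "mean n k (\<lambda>A. (total_ones n k (s n) (N n) A / real (N n))^2) =
         1 / real (N n)^2 * mean n k (\<lambda>A. (total_ones n k (s n) (N n) A)^2)"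
        unfolding mean_cmult[symmetric] by (simp add: power_divide)
      also have "\<dots> \<le> 1 / real (N n)^2 * (real (N n) * (\<mu> n / real n) * (1 + real (N n) * \<mu> n / (real n - 1)))"
        unfolding \<mu>_def by (intro mult_left_mono mean_total_ones_square_le[OF NS elim(2)]) simp
      also have "\<dots> = \<mu> n / real n * (1 / real (N n) + \<mu> n / (real n - 1))"
        using elim(1) by (simp add: power2_eq_square distrib_left)
      finally show ?case .
    qed
    have "(\<lambda>n. \<mu> n / real n * (1 / real (N n) + \<mu> n / (real n - 1))) \<longlonglongrightarrow> 1 * (0 + 1)"
      by (intro tendsto_mult tendsto_add \<mu> iN ratio_tendsto[OF \<mu>])
    then show "(\<lambda>n. \<mu> n / real n * (1 / real (N n) + \<mu> n / (real n - 1))) \<longlonglongrightarrow> 1\<^sup>2" by simp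
  qed (use \<delta> in auto)
qed

text \<open>For C = 1 the mean of the squared count per box tends to C + C^2 = 2, and the second
  moment of the average over the boxes is at most 4 in the limit.\<close>

lemma total_squares_concentration:
  fixes k :: nat
  defines "N \<equiv> num_boxes k 1" and "s \<equiv> side k 1"
  assumes k: "k \<ge> 1" and \<delta>: "\<delta> > 0"
  shows "(\<lambda>n. mean n k (\<lambda>A. of_bool (\<delta> \<le> \<bar>total_squares n k (s n) (N n) A / real (N n) - 2\<bar>))) \<longlonglongrightarrow> 0"
proof -
  define \<mu> where "\<mu> = (\<lambda>n. real (s n ^ (k + 1)))"
  have \<mu>: "(\<lambda>n. \<mu> n / real n) \<longlonglongrightarrow> 1" unfolding \<mu>_def s_def by (rule box_volume_tendsto) simp
  note \<mu>c = ratio_tendsto[OF \<mu>]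
  have sn: "(\<lambda>n. real (s n) / real n) \<longlonglongrightarrow> 0" unfolding s_def by (rule side_over_n_tendsto[OF k]) simp
  have iN: "(\<lambda>n. 1 / real (N n)) \<longlonglongrightarrow> 0" unfolding N_def by (rule inverse_num_boxes_tendsto[OF k]) simp
  have pos: "\<forall>\<^sub>F n in sequentially. N n > 0" unfolding N_def by (rule num_boxes_eventually_pos[OF k]) simp
  have NS: "N n * s n \<le> n" for n unfolding N_def s_def by (rule num_boxes_side_le)
  define a where "a = (\<lambda>n. \<mu> n / real n +
    \<mu> n / real n * (\<mu> n / real n - (real k + 1) * (real (s n) / real n)) * (real n * (real n - 2) / (real n - 1)^2))"
  \<comment> \<open>\<open>K\<close> comes from a box paired with itself; it is only bounded, but
    gets divided by the number of boxes. \<open>B\<close> comes from distinct boxes and tends to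
    \<open>2\<^sup>2\<close>.\<close>
  define K where "K = (\<lambda>n. \<mu> n / real n * (3 ^ (k + 1) + \<mu> n / (real n - 3)) ^ 3)"
  define B where "B = (\<lambda>n. \<mu> n / real n * (1 + \<mu> n / (real n - 1)) * (\<mu> n / (real n - 2)) * (1 + \<mu> n / (real n - 3)))"
  show ?thesis
  proof (rule second_moment_concentration)
    show "\<forall>\<^sub>F n in sequentially. a n \<le> mean n k (\<lambda>A. total_squares n k (s n) (N n) A / real (N n))"
      using pos eventually_gt_at_top[of 1]
    proof eventually_elim
      case (elim n)
      have "\<mu> n * (\<mu> n - (real k + 1) * real (s n)) * ((real n - 2) / (real n * (real n - 1)^2)) =
        \<mu> n / real n * (\<mu> n / real n - (real k + 1) * (real (s n) / real n)) * (real n * (real n - 2) / (real n - 1)^2)"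
        using elim(2) by (simp add: divide_simps)
      then have "real (N n) * a n \<le> mean n k (total_squares n k (s n) (N n))"
        using mean_total_squares_ge[OF NS elim(2), of k] unfolding a_def \<mu>_def by simp
      then have "a n \<le> 1 / real (N n) * mean n k (total_squares n k (s n) (N n))"
        using elim(1) by (simp add: field_simps)
      also have "\<dots> = mean n k (\<lambda>A. total_squares n k (s n) (N n) A / real (N n))"
        unfolding mean_cmult[symmetric] by simp
      finally show ?case .
    qed
    have "(\<lambda>n. real n * (real n - 2) / (real n - 1)^2) \<longlonglongrightarrow> 1" by real_asymp
    then have "a \<longlonglongrightarrow> 1 + 1 * (1 - (real k + 1) * 0) * 1"
      unfolding a_def by (intro tendsto_intros \<mu> sn)
    then show "a \<longlonglongrightarrow> 2" by simp
    show "\<forall>\<^sub>F n in sequentially. mean n k (\<lambda>A. (total_squares n k (s n) (N n) A / real (N n))^2)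
        \<le> 1 / real (N n) * K n + B n"
      using pos eventually_gt_at_top[of 3]
    proof eventually_elim
      case (elim n)
      have "mean n k (\<lambda>A. (total_squares n k (s n) (N n) A / real (N n))^2) =
         1 / real (N n)^2 * mean n k (\<lambda>A. (total_squares n k (s n) (N n) A)^2)"
        unfolding mean_cmult[symmetric] by (simp add: power_divide)
      also have "\<dots> \<le> 1 / real (N n)^2 * (real (N n) * K n + real (N n)^2 * B n)"
        unfolding \<mu>_def K_def B_def by (intro mult_left_mono mean_total_squares_square_le[OF NS elim(2)]) simp
      also have "\<dots> = 1 / real (N n) * K n + B n"
        using elim(1) by (simp add: power2_eq_square distrib_left)
      finally show ?case .
    qed
    have "K \<longlonglongrightarrow> 1 * (3 ^ (k + 1) + 1) ^ 3"
      unfolding K_def by (intro tendsto_mult tendsto_power tendsto_add tendsto_const \<mu> \<mu>c)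
    moreover have "B \<longlonglongrightarrow> 1 * (1 + 1) * 1 * (1 + 1)"
      unfolding B_def by (intro tendsto_mult tendsto_add tendsto_const \<mu> \<mu>c)
    ultimately have "(\<lambda>n. 1 / real (N n) * K n + B n)
        \<longlonglongrightarrow> 0 * (1 * (3 ^ (k + 1) + 1) ^ 3) + 1 * (1 + 1) * 1 * (1 + 1)"
      by (intro tendsto_mult[OF iN] tendsto_add)
    then show "(\<lambda>n. 1 / real (N n) * K n + B n) \<longlonglongrightarrow> 2\<^sup>2" by simp
  qed (use \<delta> in auto)
qed

text \<open>With \<open>X - X\<^sup>2 / 4\<close> as lower bound for the indicator of \<open>X > 0\<close>, the expected number of ones in
  a box tending to \<open>1\<close> and its second moment to \<open>2\<close>, about half of the boxes contain a one.\<close>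

lemma prob_normalized_lt_tendsto:
  assumes k: "k \<ge> 1"
  shows "(\<lambda>n. mean n k (\<lambda>A. of_bool (normalized_H n k A < 1 / (real k + 2)))) \<longlonglongrightarrow> 0"
proof -
  define N where "N = num_boxes k 1"
  define T where "T = (\<lambda>n A. total_ones n k (side k 1 n) (N n) A)"
  define S where "S = (\<lambda>n A. total_squares n k (side k 1 n) (N n) A)"
  define w where "w = (\<lambda>n. real n powr (- (real k / real (k + 1))))"
  \<comment> \<open>The tolerance 1/20 leaves T - S/4 >= (19/20 - 41/80) N = 7/16 N. Together with
    the factor 4/5 for the scaled number of boxes this is 7/20, above 1/3 and hence above
    \<open>1 / (k + 2)\<close>.\<close>
  define badT where "badT = (\<lambda>n A. (1/20::real) \<le> \<bar>T n A / real (N n) - 1\<bar>)"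
  define badS where "badS = (\<lambda>n A. (1/20::real) \<le> \<bar>S n A / real (N n) - 2\<bar>)"
  have "(\<lambda>n. real (N n) * w n) \<longlonglongrightarrow> 1"
    using num_boxes_tendsto[OF k, of 1] unfolding N_def w_def by simp
  then have large: "\<forall>\<^sub>F n in sequentially. 4/5 < real (N n) * w n"
    by (rule order_tendstoD) simp
  show ?thesis
  proof (rule tendsto_sandwich[OF _ _ tendsto_const])
    show "(\<lambda>n. mean n k (\<lambda>A. of_bool (badT n A)) + mean n k (\<lambda>A. of_bool (badS n A))) \<longlonglongrightarrow> 0"
      using tendsto_add[OF total_ones_concentration[OF k, of "1/20"] total_squares_concentration[OF k, of "1/20"]]
      unfolding badT_def badS_def T_def S_def N_def by simp
    show "\<forall>\<^sub>F n in sequentially. mean n k (\<lambda>A. of_bool (normalized_H n k A < 1 / (real k + 2)))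
       \<le> mean n k (\<lambda>A. of_bool (badT n A)) + mean n k (\<lambda>A. of_bool (badS n A))"
      using large num_boxes_eventually_pos[OF k, of 1, folded N_def, OF zero_less_one]
    proof eventually_elim
      case (elim n)
      have "(of_bool (normalized_H n k A < 1 / (real k + 2)) :: real) \<le> of_bool (badT n A) + of_bool (badS n A)" for A
      proof -
        have "1 / (real k + 2) \<le> normalized_H n k A" if ok: "\<not> badT n A" "\<not> badS n A"
        proof -
          have N0: "real (N n) > 0" using elim(2) by simp
          have "T n A / real (N n) \<ge> 19/20" "S n A / real (N n) \<le> 41/20"
            using ok unfolding badT_def badS_def by linarith+
          then have TS: "T n A \<ge> 19/20 * real (N n)" "S n A \<le> 41/20 * real (N n)"
            using N0 by (simp_all add: field_simps)
          have "2 * (1/2) * T n A - (1/2)^2 * S n A \<le> real (longest_monotone n k A)"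
            unfolding T_def S_def by (rule longest_monotone_ge_totals)
          then have "7/16 * real (N n) \<le> real (longest_monotone n k A)"
            using TS by (simp add: power2_eq_square)
          then have "7/16 * real (N n) * w n \<le> normalized_H n k A"
            unfolding normalized_H_def w_def by (intro mult_right_mono) auto
          then have "7/16 * (real (N n) * w n) \<le> normalized_H n k A" by (simp only: mult.assoc)
          moreover have "1 / (real k + 2) \<le> 1/3" using k by (simp add: field_simps)
          ultimately show ?thesis using elim(1) by linarith
        qed
        then show ?thesis by (cases "badT n A"; cases "badS n A") auto
      qed
      then show ?case unfolding mean_add[symmetric] by (intro mean_mono)
    qed
  qed (simp add: mean_nonneg)
qed

section \<open>The two-sided statement in probability and the o(1) form of the expectation
  bounds\<close>

lemma prob_normalized_tendsto:
  assumes k: "k \<ge> 1" and e: "e > 0"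
  shows "(\<lambda>n. mean n k (\<lambda>A. of_bool (normalized_H n k A \<in> {1 / (real k + 2)..exp 1 + e}))) \<longlonglongrightarrow> 1"
proof -
  define c where "c = exp 1 + e"
  have c: "c > exp 1" unfolding c_def using e by simp
  have "(\<lambda>n. 1 - mean n k (\<lambda>A. of_bool (normalized_H n k A < 1 / (real k + 2)))
      - mean n k (\<lambda>A. of_bool (normalized_H n k A > c))) \<longlonglongrightarrow> 1 - 0 - 0"
    by (intro tendsto_diff tendsto_const prob_normalized_lt_tendsto[OF k] prob_normalized_gt_tendsto(2)[OF k c])
  then have lim: "(\<lambda>n. 1 - mean n k (\<lambda>A. of_bool (normalized_H n k A < 1 / (real k + 2)))
      - mean n k (\<lambda>A. of_bool (normalized_H n k A > c))) \<longlonglongrightarrow> 1" by simp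
  show ?thesis unfolding c_def[symmetric]
  proof (rule tendsto_sandwich[OF _ _ lim tendsto_const])
    show "\<forall>\<^sub>F n in sequentially. 1 - mean n k (\<lambda>A. of_bool (normalized_H n k A < 1 / (real k + 2)))
      - mean n k (\<lambda>A. of_bool (normalized_H n k A > c))
      \<le> mean n k (\<lambda>A. of_bool (normalized_H n k A \<in> {1 / (real k + 2)..c}))"
    proof (intro always_eventually allI)
      fix n
      have "mean n k (\<lambda>A. 1 - of_bool (normalized_H n k A < 1 / (real k + 2)) - of_bool (normalized_H n k A > c))
        \<le> mean n k (\<lambda>A. of_bool (normalized_H n k A \<in> {1 / (real k + 2)..c}))"
        by (rule mean_mono) auto
      then show "1 - mean n k (\<lambda>A. of_bool (normalized_H n k A < 1 / (real k + 2)))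
        - mean n k (\<lambda>A. of_bool (normalized_H n k A > c))
        \<le> mean n k (\<lambda>A. of_bool (normalized_H n k A \<in> {1 / (real k + 2)..c}))"
        by (simp add: mean_diff mean_const)
    qed
    show "\<forall>\<^sub>F n in sequentially. mean n k (\<lambda>A. of_bool (normalized_H n k A \<in> {1 / (real k + 2)..c})) \<le> 1"
    proof (intro always_eventually allI)
      fix n
      have "mean n k (\<lambda>A. of_bool (normalized_H n k A \<in> {1 / (real k + 2)..c})) \<le> mean n k (\<lambda>A. 1)"
        by (rule mean_mono) simp
      then show "mean n k (\<lambda>A. of_bool (normalized_H n k A \<in> {1 / (real k + 2)..c})) \<le> 1"
        by (simp add: mean_const)
    qed
  qed
qed

text \<open>The positive part converts a one-sided eventual bound into an o(1) error term, and with
  this error the inequality holds at every \<open>n\<close>, not only eventually.\<close>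

lemma smallo_1_posI:
  fixes f :: "nat \<Rightarrow> real"
  assumes "\<And>e. e > 0 \<Longrightarrow> \<forall>\<^sub>F n in sequentially. f n \<le> e"
  shows "(\<lambda>n. max 0 (f n)) \<in> o(\<lambda>_. 1 :: real)"
proof (rule smalloI_tendsto)
  have "(\<lambda>n. max 0 (f n)) \<longlonglongrightarrow> 0"
  proof (rule tendstoI)
    fix e :: real assume "e > 0"
    then show "\<forall>\<^sub>F n in sequentially. dist (max 0 (f n)) 0 < e"
      using assms[of "e / 2"] by (auto elim!: eventually_mono)
  qed
  then show "(\<lambda>n. max 0 (f n) / 1) \<longlonglongrightarrow> 0" by simp
qed simp

theorem theorem13:
  fixes k :: nat
  assumes "k \<ge> 1"
  shows "(\<forall>\<epsilon>>0. (\<lambda>n. measure_pmf.prob (random_hd_perm n k)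
              {A. normalized_H n k A \<in> {1 / (real k + 2)..exp 1 + \<epsilon>}}) \<longlonglongrightarrow> 1) \<and>
         (\<exists>\<delta>\<^sub>1 \<in> o(\<lambda>_. 1 :: real). \<exists>\<delta>\<^sub>2 \<in> o(\<lambda>_. 1 :: real). \<forall>n\<ge>1.
            1 - (ln (real k) + 1) / (real k + 1) - \<delta>\<^sub>1 n
              \<le> measure_pmf.expectation (random_hd_perm n k) (normalized_H n k) \<and>
            measure_pmf.expectation (random_hd_perm n k) (normalized_H n k)
              \<le> exp 1 + \<delta>\<^sub>2 n)"
proof (intro conjI allI impI)
  fix \<epsilon> :: real assume "\<epsilon> > 0"
  then show "(\<lambda>n. measure_pmf.prob (random_hd_perm n k)
      {A. normalized_H n k A \<in> {1 / (real k + 2)..exp 1 + \<epsilon>}}) \<longlonglongrightarrow> 1"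
    unfolding prob_eq_mean by (rule prob_normalized_tendsto[OF assms])
next
  define c where "c = 1 - (ln (real k) + 1) / (real k + 1)"
  define E where "E = (\<lambda>n. mean n k (normalized_H n k))"
  have "(\<lambda>n. max 0 (c - E n)) \<in> o(\<lambda>_. 1 :: real)"
  proof (rule smallo_1_posI)
    fix e :: real assume "e > 0"
    from mean_normalized_H_eventually_ge[OF assms this]
    show "\<forall>\<^sub>F n in sequentially. c - E n \<le> e"
      by eventually_elim (simp add: c_def E_def)
  qed
  moreover have "(\<lambda>n. max 0 (E n - exp 1)) \<in> o(\<lambda>_. 1 :: real)"
  proof (rule smallo_1_posI)
    fix e :: real assume "e > 0"
    from mean_normalized_H_eventually_le[OF assms this]
    show "\<forall>\<^sub>F n in sequentially. E n - exp 1 \<le> e"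
      by eventually_elim (simp add: E_def)
  qed
  moreover have "c - max 0 (c - E n) \<le> E n" "E n \<le> exp 1 + max 0 (E n - exp 1)" for n
    by linarith+
  ultimately show "\<exists>\<delta>\<^sub>1 \<in> o(\<lambda>_. 1 :: real). \<exists>\<delta>\<^sub>2 \<in> o(\<lambda>_. 1 :: real). \<forall>n\<ge>1.
      1 - (ln (real k) + 1) / (real k + 1) - \<delta>\<^sub>1 n
        \<le> measure_pmf.expectation (random_hd_perm n k) (normalized_H n k) \<and>
      measure_pmf.expectation (random_hd_perm n k) (normalized_H n k) \<le> exp 1 + \<delta>\<^sub>2 n"
    unfolding expectation_eq_mean c_def[symmetric] fun_cong[OF E_def, symmetric]
    by (intro bexI[where x = "\<lambda>n. max 0 (c - E n)"] bexI[where x = "\<lambda>n. max 0 (E n - exp 1)"]) auto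
qed

end
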